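(* Let $W$ be a compact closed oriented $3$-manifold, $L\subset W$ a non-empty link, and $\rho$ a flat principal $PSL(2,\mathbb{C})$-bundle over $W$. Let $-W$ denote $W$ with the opposite orientation and $\rho^*$ the complex conjugate bundle. For every odd integer $N>1$, $$\bigl(H_N(W,L,\rho)\bigr)^*\equiv_N\pm\,H_N(-W,L,\rho^* ),$$ where $(\cdot)^*$ on the left is complex conjugation and $\equiv_N$ means equality up to multiplication by $N$-th roots of unity.
   Context: If $\rho$ is represented by a $PSL(2,\mathbb{C})$-valued $1$-cocycle $z$, then $\rho^*$ is represented by the entrywise complex conjugate cocycle $z^*$. $H_N(W,L,\rho)$ is the complex number, well defined up to sign and multiplication by $N$-th roots of unity, given by the value $H_N(\mathcal{T}_{\mathcal{I}},c)$ (defined below) for any charged $\mathcal{D}$-triangulation $(\mathcal{T},c)$ of $(W,L,\rho)$; such triangulations exist and the value does not depend on the choice, up to this ambiguity. Triangulations. A triangulation $T$ of $W$ is a singular triangulation: a finite family of oriented abstract tetrahedra (with the orientation of $W$) with identifications of pairs of distinct abstract $2$-faces, with quotient $W$; self-adjacencies and multiple adjacencies are allowed. Edges and $2$-faces "of $T$" are taken after identification. $E(T)$ is the set of edges of $T$, $E_\Delta(T)$ the set of all edges of the abstract tetrahedra, $\epsilon_T:E_\Delta(T)\to E(T)$ the identification map. $T$ is quasi-regular if every edge of $T$ has two distinct endpoints. Branchings. A branching $b$ of $T$ is a choice of orientation for each edge of $T$ which on every abstract tetrahedron comes from a total ordering $v_0,v_1,v_2,v_3$ of its vertices, each edge pointing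 from its smaller to its larger endpoint. Put $e_0=[v_0,v_1]$, $e_1=[v_1,v_2]$, $e_2=[v_0,v_2]$, and let $e'_j$ be the edge opposite to $e_j$. The index $*_b$ of the tetrahedron is $1$ if the orientation given by the ordered triple $([v_0,v_1],[v_0,v_2],[v_0,v_3])$ agrees with that of the ambient manifold, and $-1$ otherwise. Cocycles. A $PSL(2,\mathbb{C})$-valued $1$-cocycle $z$ on $T$ assigns $z(e)\in PSL(2,\mathbb{C})$ to each oriented edge, with $z(-e)=z(e)^{-1}$ and $z([x,y])z([y,t])=z([x,t])$ on each $2$-face with vertices $x,y,t$. Two cocycles are equivalent if they differ by $z'(e)=\lambda(v)^{-1}z(e)\lambda(v')$ ($e$ from $v$ to $v'$) for some $PSL(2,\mathbb{C})$-valued function $\lambda$ on the vertices; equivalence classes correspond to isomorphism classes of flat principal $PSL(2,\mathbb{C})$-bundles on $W$. Idealization. $PSL(2,\mathbb{C})$ acts on $\mathbb{CP}^1$ by Moebius transformations. On a branched tetrahedron with cocycle $z$ write $z_j=z(e_j)$, $z'_j=z(e'_j)$. It is idealizable if $u_0=0$, $u_1=z_0(0)$, $u_2=z_0z_1(0)$, $u_3=z_0z_1z'_0(0)$ are $4$ distinct points of $\mathbb{C}$. Then put $p_0=u_1(u_3-u_2)$, $p_1=(u_2-u_1)u_3$, $p_2=-u_2(u_3-u_1)$ (so $p_0+p_1+p_2=0$), $w_j=-p_{j+1}/p_{j+2}$ (indices mod $3$), $w(e_j)=w(e'_j)=w_j\in\mathbb{C}\setminus\{0,1\}$, $w=(w_0,w_1,w_2)$;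 $(\Delta,b,w)$ is the idealization of $(\Delta,b,z)$. $(T,b,z)$ is idealizable if all its abstract tetrahedra are; its idealization is the family of idealizations. Distinguished triangulations. A distinguished triangulation of $(W,L)$ is a pair $(T,H)$ with $T$ a triangulation of $W$ and $H$ a subcomplex of the $1$-skeleton of $T$ realizing $L$ and containing all the vertices of $T$. A $\mathcal{D}$-triangulation for $(W,L,\rho)$ is $\mathcal{T}=(T,H,b,z)$ where $(T,H)$ is distinguished, $T$ is quasi-regular, $b$ is a branching, and $z$ is an idealizable cocycle on $(T,b)$ representing $\rho$. $\mathcal{T}_{\mathcal{I}}=(T,b,w)$ is its idealization. Charges. An integral charge on $(T,H)$ is a map $c:E_\Delta(T)\to\mathbb{Z}$ such that: on each abstract tetrahedron opposite edges have the same charge and $c_0+c_1+c_2=1$, where $c_j=c(e_j)$; $\sum_{a\in\epsilon_T^{-1}(e)}c(a)=2$ for each $e\in E(T)\setminus E(H)$ and $=0$ for each $e\in E(H)$; and for every simple closed curve $s$ in general position with respect to $T$ without back-tracking (it never leaves a tetrahedron through the $2$-face by which it entered) the sum of the charges of the selected edges (at each passage through a tetrahedron, the edge common to the entering and departing faces) is even. $(\mathcal{T},c)$ is then a charged $\mathcal{D}$-triangulation. State sums. Let $N=2p+1>1$ be odd, $\zeta=\exp(2i\pi/N)$; exponents $1/2$ of $\zeta$ mean $p+1$ mod $N$, so $\zeta^{\alpha^2/2}=\zeta^{(p+1)\alpha^2}$. Let $g(x)=\prod_{j=1}^{N-1}(1-x\zeta^j)^{j/N}$ for $|x|<1$, analytically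 continued to the plane with cuts from the points $\exp(i\epsilon)\zeta^k$, $k=0,\dots,N-1$, to infinity, chosen away from the points where $g$ is evaluated; $h(x)=x^{-p}g(x)/g(1)$; $\omega(x,y,z|n)=\prod_{j=1}^n\frac{y/z}{1-(x/z)\zeta^j}$ for $x^N+y^N=z^N$ ($N$-periodic in $n$); $[x]=N^{-1}(1-x^N)/(1-x)$; $\delta$ is the $N$-periodic Kronecker symbol ($\delta(n)=1$ if $N|n$, else $0$). Put $$R(x,y,z)_{\alpha,\beta}^{\gamma,\delta}=h(z/x)\,\zeta^{\alpha\delta+\frac{\alpha^2}{2}}\,\omega(x,y,z|\gamma-\alpha)\,\delta(\gamma+\delta-\beta),$$ $$\bar R(x,y,z)_{\gamma,\delta}^{\alpha,\beta}=\frac{[x/z]}{h(z/x)}\,\zeta^{-\alpha\delta-\frac{\alpha^2}{2}}\,\frac{\delta(\gamma+\delta-\beta)}{\omega(x/\zeta,y,z|\gamma-\alpha)}.$$ For a charged tetrahedron $(\Delta,b,w,c)$ let $p'_i$ be $N$-th roots of the $p_i$ taken with a common determination (the result is asserted not to depend on it), $c'_j=(p+1)c_j$ mod $N$, and $\kappa=(-p'_1/p'_2)^{-c_1}(-p'_2/p'_0)^{c_0}$. Let $F_j$ be the $2$-face opposite to $v_j$. For a map $s$ from the $2$-faces to $\{0,\dots,N-1\}$ put $\alpha=s(F_3)$, $\beta=s(F_1)$, $\gamma=s(F_2)$, $\delta=s(F_0)$ and $$\mathfrak{R}_N(\Delta,b,w,c)_s=\kappa^p\,\zeta^{c'_1(\gamma-\alpha)}R(p'_1,p'_0,-p'_2)_{\alpha,\beta-c'_0}^{\gamma-c'_0,\delta}\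 \text{ if } *_b=1,$$ $$\mathfrak{R}_N(\Delta,b,w,c)_s=\kappa^p\,\zeta^{c'_1(\gamma-\alpha)}\bar R(p'_1,p'_0,-p'_2)_{\gamma+c'_0,\delta}^{\alpha,\beta+c'_0}\ \text{ if } *_b=-1.$$ Then $\mathfrak{R}_N(\mathcal{T}_{\mathcal{I}},c)=\sum_s\prod_i\mathfrak{R}_N(\Delta_i,b_i,w_i,c_i)_s$, where $s$ runs over all maps from the $2$-faces of $T$ to $\{0,\dots,N-1\}$ and $i$ over the abstract tetrahedra, and $H_N(\mathcal{T}_{\mathcal{I}},c)=N^{-n_0}\mathfrak{R}_N(\mathcal{T}_{\mathcal{I}},c)$ with $n_0$ the number of vertices of $T$. *)

theory Defs
  imports "HOL-Analysis.Analysis" "HOL-Homology.Homology" "HOL-Combinatorics.Permutations"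
begin

section \<open>Closed oriented 3-manifolds and links\<close>

text \<open>An orientation is given in the homological way: a locally consistent choice of generators
  of the local homology groups \<open>H\<^sub>3(X, X - {x})\<close>.\<close>

record 'a oriented_space =
  underlying :: "'a topology"
  orientation :: "'a \<Rightarrow> 'a chain set"

abbreviation local_homology :: "'a topology \<Rightarrow> 'a set \<Rightarrow> 'a chain set monoid" where
  "local_homology X U \<equiv> relative_homology_group 3 X (topspace X - U)"

definition is_orientation :: "'a topology \<Rightarrow> ('a \<Rightarrow> 'a chain set) \<Rightarrow> bool" where
  "is_orientation X \<mu> \<longleftrightarrow>
     (\<forall>x\<in>topspace X. \<mu> x \<in> carrier (local_homology X {x}) \<and>
        generate (local_homology X {x}) {\<mu> x} = carrier (local_homology X {x})) \<and>
     (\<forall>x\<in>topspace X. \<exists>U. openin X U \<and> x \<in> U \<and>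
        (\<exists>\<alpha>\<in>carrier (local_homology X U). \<forall>y\<in>U.
           hom_induced 3 X (topspace X - U) X (topspace X - {y}) id \<alpha> = \<mu> y))"

definition closed_oriented_3manifold :: "'a oriented_space \<Rightarrow> bool" where
  "closed_oriented_3manifold W \<longleftrightarrow>
     compact_space (underlying W) \<and> Hausdorff_space (underlying W) \<and>
     (\<forall>x\<in>topspace (underlying W). \<exists>U. openin (underlying W) U \<and> x \<in> U \<and>
        subtopology (underlying W) U homeomorphic_space (euclidean :: (real^3) topology)) \<and>
     is_orientation (underlying W) (orientation W)"

definition opposite :: "'a oriented_space \<Rightarrow> 'a oriented_space" where
  "opposite W = W\<lparr>orientation :=
     (\<lambda>x. inv\<^bsub>local_homology (underlying W) {x}\<^esub> (orientation W x))\<rparr>"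

text \<open>A link is a finite disjoint union of (unoriented) circles, tame in the sense of being
  locally flat.\<close>

definition is_link :: "'a oriented_space \<Rightarrow> 'a set \<Rightarrow> bool" where
  "is_link W L \<longleftrightarrow>
     L \<subseteq> topspace (underlying W) \<and>
     (\<exists>\<C>. finite \<C> \<and> disjoint \<C> \<and> L = \<Union>\<C> \<and>
        (\<forall>C\<in>\<C>. subtopology (underlying W) C homeomorphic_space
                  top_of_set (sphere (0::complex) 1))) \<and>
     (\<forall>x\<in>L. \<exists>U f. openin (underlying W) U \<and> x \<in> U \<and>
        homeomorphic_map (subtopology (underlying W) U) (euclidean :: (real^3) topology) f \<and>
        f ` (U \<inter> L) = {v. v$1 = 0 \<and> v$2 = 0})"

section \<open>PSL(2,C) and flat bundles\<close>

type_synonym psl = "(complex^2^2) set"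

definition SL2C :: "(complex^2^2) monoid" where
  "SL2C = \<lparr>carrier = {A. det A = 1}, monoid.mult = (**), one = mat 1\<rparr>"

definition PSL2C :: "psl monoid" where
  "PSL2C = SL2C Mod {mat 1, - mat 1}"

definition psl_cnj :: "psl \<Rightarrow> psl" where
  "psl_cnj g = (\<lambda>A. \<chi> i j. cnj (A$i$j)) ` g"

text \<open>The projective line is \<open>complex option\<close>, with \<open>None\<close> the point at infinity.\<close>

definition moebius_CP1 :: "complex^2^2 \<Rightarrow> complex option \<Rightarrow> complex option" where
  "moebius_CP1 A w = (case w of
       None \<Rightarrow> if A$2$1 = 0 then None else Some (A$1$1 / A$2$1)
     | Some u \<Rightarrow> if A$2$1 * u + A$2$2 = 0 then None
                 else Some (moebius (A$1$1) (A$1$2) (A$2$1) (A$2$2) u))"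

text \<open>The two representatives of a coset act in the same way.\<close>

definition psl_act :: "psl \<Rightarrow> complex option \<Rightarrow> complex option" where
  "psl_act g = moebius_CP1 (SOME A. A \<in> g)"

record ('a, 'e) psl_bundle =
  total :: "'e topology"
  proj :: "'e \<Rightarrow> 'a"
  act :: "'e \<Rightarrow> psl \<Rightarrow> 'e"

text \<open>A flat principal bundle is a principal bundle (with right action) whose structure group
  carries the discrete topology; its local trivializations are then the flat ones.\<close>

definition flat_psl_bundle :: "'a oriented_space \<Rightarrow> ('a, 'e) psl_bundle \<Rightarrow> bool" where
  "flat_psl_bundle W \<rho> \<longleftrightarrow>
     continuous_map (total \<rho>) (underlying W) (proj \<rho>) \<and>
     (\<forall>e\<in>topspace (total \<rho>). act \<rho> e \<one>\<^bsub>PSL2C\<^esub> = e) \<and>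
     (\<forall>e\<in>topspace (total \<rho>). \<forall>g\<in>carrier PSL2C.
        act \<rho> e g \<in> topspace (total \<rho>) \<and> proj \<rho> (act \<rho> e g) = proj \<rho> e) \<and>
     (\<forall>e\<in>topspace (total \<rho>). \<forall>g\<in>carrier PSL2C. \<forall>h\<in>carrier PSL2C.
        act \<rho> (act \<rho> e g) h = act \<rho> e (g \<otimes>\<^bsub>PSL2C\<^esub> h)) \<and>
     (\<forall>x\<in>topspace (underlying W). \<exists>U \<psi>. openin (underlying W) U \<and> x \<in> U \<and>
        homeomorphic_map
          (subtopology (total \<rho>) {e \<in> topspace (total \<rho>). proj \<rho> e \<in> U})
          (prod_topology (subtopology (underlying W) U) (discrete_topology (carrier PSL2C))) \<psi> \<and>
        (\<forall>e\<in>topspace (total \<rho>). proj \<rho> e \<in> U \<longrightarrow> fst (\<psi> e) = proj \<rho> e \<and>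
           (\<forall>g\<in>carrier PSL2C. \<psi> (act \<rho> e g) = (proj \<rho> e, snd (\<psi> e) \<otimes>\<^bsub>PSL2C\<^esub> g))))"

text \<open>The bundle associated with \<open>\<rho>\<close> by the automorphism \<open>psl_cnj\<close> of the structure group: the
  same covering, on which \<open>g\<close> acts as its conjugate did. If a cocycle \<open>z\<close> represents \<open>\<rho>\<close> (in the
  sense of \<open>represents\<close> below), then the conjugate cocycle represents \<open>conj_bundle \<rho>\<close>.\<close>

definition conj_bundle :: "('a, 'e) psl_bundle \<Rightarrow> ('a, 'e) psl_bundle" where
  "conj_bundle \<rho> = \<rho>\<lparr>act := (\<lambda>e g. act \<rho> e (psl_cnj g))\<rparr>"

section \<open>Singular triangulations\<close>

text \<open>The abstract tetrahedra are numbered \<open>0, \<dots>, ntet T - 1\<close>; each has vertices labelled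
  \<open>0, 1, 2, 3\<close>, and its face number \<open>k\<close> is the one opposite to the vertex \<open>k\<close>.
  If \<open>glue T i k = (j, \<sigma>)\<close> then face \<open>k\<close> of tetrahedron \<open>i\<close> is identified with face \<open>\<sigma> k\<close> of
  tetrahedron \<open>j\<close>, the vertex \<open>a \<noteq> k\<close> going to \<open>\<sigma> a\<close>. The number \<open>ori T i\<close> is \<open>1\<close> if the chosen
  orientation of tetrahedron \<open>i\<close> is the one of the vertex ordering \<open>0, 1, 2, 3\<close>, and \<open>-1\<close>
  otherwise.\<close>

record triang =
  ntet :: nat
  glue :: "nat \<Rightarrow> nat \<Rightarrow> nat \<times> (nat \<Rightarrow> nat)"
  ori :: "nat \<Rightarrow> int"

definition gluing_ok :: "triang \<Rightarrow> bool" where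
  "gluing_ok T \<longleftrightarrow>
     (\<forall>i<ntet T. ori T i \<in> {1, -1}) \<and>
     (\<forall>i<ntet T. \<forall>k\<le>3. \<forall>j \<sigma>. glue T i k = (j, \<sigma>) \<longrightarrow>
        j < ntet T \<and> \<sigma> permutes {..3} \<and> (j, \<sigma> k) \<noteq> (i, k) \<and> glue T j (\<sigma> k) = (i, inv_into UNIV \<sigma>))"

text \<open>A simplex of an abstract tetrahedron is a pair \<open>(i, S)\<close> with \<open>S\<close> its set of vertices;
  a cell of \<open>T\<close> is a class of such pairs under the identifications.\<close>

definition simplex_glue :: "triang \<Rightarrow> ((nat \<times> nat set) \<times> (nat \<times> nat set)) set" where
  "simplex_glue T = {((i, S), (j, \<sigma> ` S)) | i S j \<sigma>.
     i < ntet T \<and> S \<subseteq> {..3} \<and> (\<exists>k\<le>3. k \<notin> S \<and> glue T i k = (j, \<sigma>))}"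

definition cell_of :: "triang \<Rightarrow> nat \<Rightarrow> nat set \<Rightarrow> (nat \<times> nat set) set" where
  "cell_of T i S = (simplex_glue T)\<^sup>* `` {(i, S)}"

definition cells :: "triang \<Rightarrow> nat \<Rightarrow> (nat \<times> nat set) set set" where
  "cells T d = {cell_of T i S | i S. i < ntet T \<and> S \<subseteq> {..3} \<and> card S = d + 1}"

definition quasi_regular :: "triang \<Rightarrow> bool" where
  "quasi_regular T \<longleftrightarrow>
     (\<forall>i<ntet T. \<forall>a\<le>3. \<forall>a'\<le>3. a \<noteq> a' \<longrightarrow> cell_of T i {a} \<noteq> cell_of T i {a'})"

text \<open>Geometric simplices, in the coordinates of \<open>standard_simplex 3\<close>.\<close>

abbreviation simplex3 :: "(nat \<Rightarrow> real) topology" where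
  "simplex3 \<equiv> subtopology (powertop_real UNIV) (standard_simplex 3)"

definition closed_cell :: "nat set \<Rightarrow> (nat \<Rightarrow> real) set" where
  "closed_cell S = {x \<in> standard_simplex 3. \<forall>a\<le>3. a \<notin> S \<longrightarrow> x a = 0}"

definition open_cell :: "nat set \<Rightarrow> (nat \<Rightarrow> real) set" where
  "open_cell S = {x \<in> standard_simplex 3. \<forall>a\<le>3. 0 < x a \<longleftrightarrow> a \<in> S}"

definition vertex :: "nat \<Rightarrow> nat \<Rightarrow> real" where
  "vertex a = (\<lambda>m. if m = a then 1 else 0)"

definition edge_point :: "nat \<Rightarrow> nat \<Rightarrow> real \<Rightarrow> nat \<Rightarrow> real" where
  "edge_point a a' t = (\<lambda>m. (1 - t) * vertex a m + t * vertex a' m)"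

definition point_glue :: "triang \<Rightarrow> ((nat \<times> (nat \<Rightarrow> real)) \<times> (nat \<times> (nat \<Rightarrow> real))) set" where
  "point_glue T = {((i, x), (j, x \<circ> inv_into UNIV \<sigma>)) | i x j \<sigma>.
     i < ntet T \<and> (\<exists>k\<le>3. x \<in> closed_cell ({..3} - {k}) \<and> glue T i k = (j, \<sigma>))}"

text \<open>The characteristic maps \<open>\<phi> i\<close> of the tetrahedra present \<open>W\<close> as the quotient of their disjoint
  union by the identifications, and carry the orientations of the tetrahedra to that of \<open>W\<close>.
  Here the singular simplex \<open>\<phi> i\<close> defines the local orientation for which the vectors from
  vertex 0 to the vertices 1, 2, 3 form a positive triple.\<close>

definition triangulates :: "'a oriented_space \<Rightarrow> triang \<Rightarrow> (nat \<Rightarrow> (nat \<Rightarrow> real) \<Rightarrow> 'a) \<Rightarrow> bool" where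
  "triangulates W T \<phi> \<longleftrightarrow>
     gluing_ok T \<and>
     quotient_map (sum_topology (\<lambda>i. simplex3) {..<ntet T}) (underlying W) (\<lambda>(i, x). \<phi> i x) \<and>
     (\<forall>i<ntet T. \<forall>j<ntet T. \<forall>x\<in>standard_simplex 3. \<forall>y\<in>standard_simplex 3.
        \<phi> i x = \<phi> j y \<longleftrightarrow> ((i, x), (j, y)) \<in> (point_glue T)\<^sup>*) \<and>
     (\<forall>i<ntet T. \<forall>x\<in>open_cell {..3}.
        homologous_rel_set 3 (underlying W) (topspace (underlying W) - {\<phi> i x})
            (frag_of (restrict (\<phi> i) (standard_simplex 3))) =
        (if ori T i = 1 then orientation W (\<phi> i x)
         else inv\<^bsub>local_homology (underlying W) {\<phi> i x}\<^esub> (orientation W (\<phi> i x))))"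

text \<open>A subcomplex of the 1-skeleton containing all the vertices is the same as a set \<open>H\<close> of
  edges, the vertices being understood.\<close>

definition distinguished ::
  "'a oriented_space \<Rightarrow> 'a set \<Rightarrow> triang \<Rightarrow> (nat \<Rightarrow> (nat \<Rightarrow> real) \<Rightarrow> 'a) \<Rightarrow>
   (nat \<times> nat set) set set \<Rightarrow> bool" where
  "distinguished W L T \<phi> H \<longleftrightarrow>
     triangulates W T \<phi> \<and> H \<subseteq> cells T 1 \<and>
     (\<Union>C \<in> cells T 0 \<union> H. \<Union>(i, S) \<in> C. \<phi> i ` closed_cell S) = L"

section \<open>Branchings, cocycles, idealization\<close>

text \<open>The branching is given by the total orderings of the vertices of the tetrahedra:
  \<open>b i m\<close> is the label of the vertex \<open>v\<^sub>m\<close> of tetrahedron \<open>i\<close>, so \<open>inv_into UNIV (b i) a\<close> is the rank of the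
  vertex labelled \<open>a\<close>. Orderings which agree on identified faces orient the edges of \<open>T\<close>, and are
  determined by these edge orientations.\<close>

definition branching :: "triang \<Rightarrow> (nat \<Rightarrow> nat \<Rightarrow> nat) \<Rightarrow> bool" where
  "branching T b \<longleftrightarrow>
     (\<forall>i<ntet T. b i permutes {..3}) \<and>
     (\<forall>i<ntet T. \<forall>k\<le>3. \<forall>j \<sigma>. glue T i k = (j, \<sigma>) \<longrightarrow>
        (\<forall>a\<in>{..3}-{k}. \<forall>a'\<in>{..3}-{k}.
           inv_into UNIV (b i) a < inv_into UNIV (b i) a' \<longleftrightarrow> inv_into UNIV (b j) (\<sigma> a) < inv_into UNIV (b j) (\<sigma> a')))"

definition tet_index :: "triang \<Rightarrow> (nat \<Rightarrow> nat \<Rightarrow> nat) \<Rightarrow> nat \<Rightarrow> int" where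
  "tet_index T b i = ori T i * sign (b i)"

text \<open>\<open>z i a a'\<close> is the value on the edge of tetrahedron \<open>i\<close> oriented from vertex \<open>a\<close> to \<open>a'\<close>.\<close>

type_synonym cocyc = "nat \<Rightarrow> nat \<Rightarrow> nat \<Rightarrow> psl"

definition cocycle :: "triang \<Rightarrow> cocyc \<Rightarrow> bool" where
  "cocycle T z \<longleftrightarrow>
     (\<forall>i<ntet T. \<forall>a\<le>3. \<forall>a'\<le>3. a \<noteq> a' \<longrightarrow>
        z i a a' \<in> carrier PSL2C \<and> z i a' a = inv\<^bsub>PSL2C\<^esub> (z i a a')) \<and>
     (\<forall>i<ntet T. \<forall>k\<le>3. \<forall>j \<sigma>. glue T i k = (j, \<sigma>) \<longrightarrow>
        (\<forall>a\<in>{..3}-{k}. \<forall>a'\<in>{..3}-{k}. a \<noteq> a' \<longrightarrow> z i a a' = z j (\<sigma> a) (\<sigma> a'))) \<and>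
     (\<forall>i<ntet T. \<forall>a\<le>3. \<forall>a'\<le>3. \<forall>a''\<le>3. a \<noteq> a' \<and> a' \<noteq> a'' \<and> a \<noteq> a'' \<longrightarrow>
        z i a a' \<otimes>\<^bsub>PSL2C\<^esub> z i a' a'' = z i a a'')"

text \<open>A choice \<open>s\<close> of points in the fibres over the vertices trivializes \<open>\<rho>\<close> there; for an edge from
  \<open>v\<close> to \<open>v'\<close>, \<open>z\<close> is determined by the requirement that parallel transport along the edge takes
  \<open>s v \<sqdot> z\<close> to \<open>s v'\<close>. Replacing \<open>s v\<close> by \<open>s v \<sqdot> \<lambda> v\<close> changes \<open>z\<close> to
  \<open>(\<lambda> v)\<^sup>-\<^sup>1 z (\<lambda> v')\<close>, so all cocycles of one equivalence class occur.\<close>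

definition represents ::
  "triang \<Rightarrow> (nat \<Rightarrow> (nat \<Rightarrow> real) \<Rightarrow> 'a) \<Rightarrow> cocyc \<Rightarrow> ('a, 'e) psl_bundle \<Rightarrow> bool" where
  "represents T \<phi> z \<rho> \<longleftrightarrow>
     (\<exists>s. (\<forall>i<ntet T. \<forall>a\<le>3. s (\<phi> i (vertex a)) \<in> topspace (total \<rho>) \<and>
             proj \<rho> (s (\<phi> i (vertex a))) = \<phi> i (vertex a)) \<and>
          (\<forall>i<ntet T. \<forall>a\<le>3. \<forall>a'\<le>3. a \<noteq> a' \<longrightarrow>
             (\<exists>\<gamma>. pathin (total \<rho>) \<gamma> \<and>
                (\<forall>t\<in>{0..1}. proj \<rho> (\<gamma> t) = \<phi> i (edge_point a a' t)) \<and>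
                \<gamma> 0 = act \<rho> (s (\<phi> i (vertex a))) (z i a a') \<and>
                \<gamma> 1 = s (\<phi> i (vertex a')))))"

definition ideal_vertex :: "(nat \<Rightarrow> nat \<Rightarrow> nat) \<Rightarrow> cocyc \<Rightarrow> nat \<Rightarrow> nat \<Rightarrow> complex option" where
  "ideal_vertex b z i m =
     (let z0 = z i (b i 0) (b i 1); z1 = z i (b i 1) (b i 2); z0' = z i (b i 2) (b i 3) in
      if m = 0 then Some 0
      else if m = 1 then psl_act z0 (Some 0)
      else if m = 2 then psl_act (z0 \<otimes>\<^bsub>PSL2C\<^esub> z1) (Some 0)
      else psl_act (z0 \<otimes>\<^bsub>PSL2C\<^esub> z1 \<otimes>\<^bsub>PSL2C\<^esub> z0') (Some 0))"

definition idealizable :: "triang \<Rightarrow> (nat \<Rightarrow> nat \<Rightarrow> nat) \<Rightarrow> cocyc \<Rightarrow> bool" where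
  "idealizable T b z \<longleftrightarrow>
     (\<forall>i<ntet T. (\<forall>m\<le>3. ideal_vertex b z i m \<noteq> None) \<and> inj_on (ideal_vertex b z i) {..3})"

text \<open>The numbers \<open>p\<^sub>0, p\<^sub>1, p\<^sub>2\<close> of tetrahedron \<open>i\<close> (recall \<open>u\<^sub>0 = 0\<close>). They determine the
  idealization by \<open>w\<^sub>j = - p\<^sub>j\<^sub>+\<^sub>1 / p\<^sub>j\<^sub>+\<^sub>2\<close>, and they are what enters the state sums.\<close>

definition pnum :: "(nat \<Rightarrow> nat \<Rightarrow> nat) \<Rightarrow> cocyc \<Rightarrow> nat \<Rightarrow> nat \<Rightarrow> complex" where
  "pnum b z i j =
     (let u1 = the (ideal_vertex b z i 1); u2 = the (ideal_vertex b z i 2);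
          u3 = the (ideal_vertex b z i 3) in
      if j = 0 then u1 * (u3 - u2) else if j = 1 then (u2 - u1) * u3 else - u2 * (u3 - u1))"

definition D_triangulation ::
  "'a oriented_space \<Rightarrow> 'a set \<Rightarrow> ('a, 'e) psl_bundle \<Rightarrow>
   triang \<Rightarrow> (nat \<Rightarrow> (nat \<Rightarrow> real) \<Rightarrow> 'a) \<Rightarrow> (nat \<times> nat set) set set \<Rightarrow>
   (nat \<Rightarrow> nat \<Rightarrow> nat) \<Rightarrow> cocyc \<Rightarrow> bool" where
  "D_triangulation W L \<rho> T \<phi> H b z \<longleftrightarrow>
     distinguished W L T \<phi> H \<and> quasi_regular T \<and> branching T b \<and>
     cocycle T z \<and> idealizable T b z \<and> represents T \<phi> z \<rho>"

section \<open>Integral charges\<close>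

text \<open>A simple closed curve in general position without back-tracking: it is cut at the times
  \<open>0 = t 0 < \<dots> < t n = 1\<close> at which it crosses the 2-skeleton, in interior points of 2-faces. Between
  \<open>t r\<close> and \<open>t (r+1)\<close> it passes through the tetrahedron \<open>i r\<close> from face \<open>k r\<close> to face
  \<open>l r \<noteq> k r\<close>, and goes on into the tetrahedron on the other side. (A curve inside
  one tetrahedron selects no edge, and the choice of base point is immaterial.)\<close>

definition transverse_curve ::
  "'a oriented_space \<Rightarrow> triang \<Rightarrow> (nat \<Rightarrow> (nat \<Rightarrow> real) \<Rightarrow> 'a) \<Rightarrow> (real \<Rightarrow> 'a) \<Rightarrow>
   nat \<Rightarrow> (nat \<Rightarrow> real) \<Rightarrow> (nat \<Rightarrow> nat) \<Rightarrow> (nat \<Rightarrow> nat) \<Rightarrow> (nat \<Rightarrow> nat) \<Rightarrow> bool" where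
  "transverse_curve W T \<phi> \<gamma> n t i k l \<longleftrightarrow>
     pathin (underlying W) \<gamma> \<and> \<gamma> 0 = \<gamma> 1 \<and> inj_on \<gamma> {0..<1} \<and>
     0 < n \<and> t 0 = 0 \<and> t n = 1 \<and>
     (\<forall>r<n. t r < t (Suc r) \<and> i r < ntet T \<and> k r \<le> 3 \<and> l r \<le> 3 \<and> k r \<noteq> l r \<and>
        (\<exists>q. continuous_map (top_of_set {t r..t (Suc r)}) simplex3 q \<and>
           (\<forall>\<tau>\<in>{t r..t (Suc r)}. \<phi> (i r) (q \<tau>) = \<gamma> \<tau>) \<and>
           (\<forall>\<tau>\<in>{t r<..<t (Suc r)}. q \<tau> \<in> open_cell {..3}) \<and>
           q (t r) \<in> open_cell ({..3} - {k r}) \<and>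
           q (t (Suc r)) \<in> open_cell ({..3} - {l r})) \<and>
        (\<exists>\<sigma>. glue T (i r) (l r) = (i (Suc r mod n), \<sigma>) \<and> \<sigma> (l r) = k (Suc r mod n)))"

text \<open>The edge common to the faces \<open>k\<close> and \<open>l\<close> of a tetrahedron is \<open>{..3} - {k, l}\<close>; the three
  edges \<open>{0,1}, {1,2}, {0,2}\<close> represent the three pairs of opposite edges.\<close>

definition integral_charge ::
  "'a oriented_space \<Rightarrow> triang \<Rightarrow> (nat \<Rightarrow> (nat \<Rightarrow> real) \<Rightarrow> 'a) \<Rightarrow> (nat \<times> nat set) set set \<Rightarrow>
   (nat \<Rightarrow> nat set \<Rightarrow> int) \<Rightarrow> bool" where
  "integral_charge W T \<phi> H c \<longleftrightarrow>
     (\<forall>i<ntet T. (\<forall>S\<subseteq>{..3}. card S = 2 \<longrightarrow> c i ({..3} - S) = c i S) \<and>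
        c i {0,1} + c i {1,2} + c i {0,2} = 1) \<and>
     (\<forall>e\<in>cells T 1. (\<Sum>(i, S)\<in>e. c i S) = (if e \<in> H then 0 else 2)) \<and>
     (\<forall>\<gamma> n t i k l. transverse_curve W T \<phi> \<gamma> n t i k l \<longrightarrow>
        even (\<Sum>r<n. c (i r) ({..3} - {k r, l r})))"

section \<open>State sums\<close>

definition zeta :: "nat \<Rightarrow> complex" where
  "zeta N = exp (2 * \<i> * of_real pi / of_nat N)"

text \<open>The half of an exponent \<open>n\<close> is \<open>half N * n\<close>, with \<open>half N = p + 1\<close> for \<open>N = 2p + 1\<close>.\<close>

definition half :: "nat \<Rightarrow> int" where
  "half N = int ((N - 1) div 2) + 1"

text \<open>The cuts run from the branch points \<open>\<zeta>\<^sup>k\<close> (\<open>k \<noteq> 0\<close>, as \<open>g\<close> does not branch at 1) to infinity,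
  rotated by the angle \<open>\<epsilon>\<close> against the radial direction.\<close>

definition cut_plane :: "nat \<Rightarrow> real \<Rightarrow> complex set" where
  "cut_plane N \<epsilon> = - {zeta N ^ k * (1 + of_real r * cis \<epsilon>) | k r. k \<in> {1..<N} \<and> 0 \<le> r}"

definition g_cont :: "nat \<Rightarrow> real \<Rightarrow> complex \<Rightarrow> complex" where
  "g_cont N \<epsilon> = (SOME G. G holomorphic_on cut_plane N \<epsilon> \<and>
     (\<forall>x\<in>ball 0 1. G x = (\<Prod>j=1..<N. (1 - x * zeta N ^ j) powr (of_nat j / of_nat N))))"

definition h_fun :: "nat \<Rightarrow> real \<Rightarrow> complex \<Rightarrow> complex" where
  "h_fun N \<epsilon> x = g_cont N \<epsilon> x / (x ^ ((N - 1) div 2) * g_cont N \<epsilon> 1)"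

definition omega :: "nat \<Rightarrow> complex \<Rightarrow> complex \<Rightarrow> complex \<Rightarrow> int \<Rightarrow> complex" where
  "omega N x y z n = (\<Prod>j=1..nat (n mod int N). (y / z) / (1 - (x / z) * zeta N ^ j))"

definition bracket :: "nat \<Rightarrow> complex \<Rightarrow> complex" where
  "bracket N x = (1 - x ^ N) / (of_nat N * (1 - x))"

definition kron :: "nat \<Rightarrow> int \<Rightarrow> complex" where
  "kron N n = (if int N dvd n then 1 else 0)"

text \<open>Arguments \<open>\<alpha> \<beta> \<gamma> \<delta>\<close>: in \<open>R_mat\<close> the lower indices are \<open>\<alpha>, \<beta>\<close> and the upper ones
  \<open>\<gamma>, \<delta>\<close>, in \<open>R_bar\<close> conversely.\<close>

definition R_mat :: "nat \<Rightarrow> real \<Rightarrow> complex \<Rightarrow> complex \<Rightarrow> complex \<Rightarrow> int \<Rightarrow> int \<Rightarrow> int \<Rightarrow> int \<Rightarrow> complex" where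
  "R_mat N \<epsilon> x y z \<alpha> \<beta> \<gamma> \<delta> =
     h_fun N \<epsilon> (z / x) * zeta N powi (\<alpha> * \<delta> + half N * \<alpha>^2) *
     omega N x y z (\<gamma> - \<alpha>) * kron N (\<gamma> + \<delta> - \<beta>)"

definition R_bar :: "nat \<Rightarrow> real \<Rightarrow> complex \<Rightarrow> complex \<Rightarrow> complex \<Rightarrow> int \<Rightarrow> int \<Rightarrow> int \<Rightarrow> int \<Rightarrow> complex" where
  "R_bar N \<epsilon> x y z \<alpha> \<beta> \<gamma> \<delta> =
     bracket N (x / z) / h_fun N \<epsilon> (z / x) * zeta N powi (- \<alpha> * \<delta> - half N * \<alpha>^2) *
     (kron N (\<gamma> + \<delta> - \<beta>) / omega N (x / zeta N) y z (\<gamma> - \<alpha>))"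

text \<open>The determination of the N-th root on the plane cut along the ray opposite to
  \<open>cis \<theta>\<close>, with arguments in \<open>(\<theta> - \<pi>, \<theta> + \<pi>)\<close>.\<close>

definition root_det :: "nat \<Rightarrow> real \<Rightarrow> complex \<Rightarrow> complex" where
  "root_det N \<theta> x = exp ((Ln (x * cis (- \<theta>)) + \<i> * of_real \<theta>) / of_nat N)"

text \<open>The tensor of tetrahedron \<open>i\<close> at the state \<open>s\<close>, with the determination \<open>\<theta>\<close> of the roots.\<close>

definition tet_tensor ::
  "nat \<Rightarrow> triang \<Rightarrow> (nat \<Rightarrow> nat \<Rightarrow> nat) \<Rightarrow> cocyc \<Rightarrow> (nat \<Rightarrow> nat set \<Rightarrow> int) \<Rightarrow>
   real \<Rightarrow> real \<Rightarrow> nat \<Rightarrow> ((nat \<times> nat set) set \<Rightarrow> int) \<Rightarrow> complex" where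
  "tet_tensor N T b z c \<epsilon> \<theta> i s =
     (let p' = (\<lambda>j. root_det N \<theta> (pnum b z i j));
          c0 = c i {b i 0, b i 1};
          c1 = c i {b i 1, b i 2};
          c0' = (half N * c0) mod int N;
          c1' = (half N * c1) mod int N;
          \<kappa> = (- p' 1 / p' 2) powi (- c1) * (- p' 2 / p' 0) powi c0;
          F = (\<lambda>m. cell_of T i ({..3} - {b i m}));
          \<alpha> = s (F 3); \<beta> = s (F 1); \<gamma> = s (F 2); \<delta> = s (F 0)
      in \<kappa> ^ ((N - 1) div 2) * zeta N powi (c1' * (\<gamma> - \<alpha>)) *
         (if tet_index T b i = 1
          then R_mat N \<epsilon> (p' 1) (p' 0) (- p' 2) \<alpha> (\<beta> - c0') (\<gamma> - c0') \<delta>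
          else R_bar N \<epsilon> (p' 1) (p' 0) (- p' 2) \<alpha> (\<beta> + c0') (\<gamma> + c0') \<delta>))"

text \<open>The auxiliary choices: the cuts for \<open>g\<close> (the angle is small enough for them to stay outside
  the unit disc) and, in each tetrahedron, a common determination of the roots avoid the points
  where they are used.\<close>

definition admissible_cuts ::
  "nat \<Rightarrow> triang \<Rightarrow> (nat \<Rightarrow> nat \<Rightarrow> nat) \<Rightarrow> cocyc \<Rightarrow> real \<Rightarrow> (nat \<Rightarrow> real) \<Rightarrow> bool" where
  "admissible_cuts N T b z \<epsilon> \<theta> \<longleftrightarrow>
     \<bar>\<epsilon>\<bar> < pi / 2 \<and>
     (\<forall>i<ntet T. (\<forall>j<3. pnum b z i j * cis (- \<theta> i) \<notin> \<real>\<^sub>\<le>\<^sub>0) \<and>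
        - root_det N (\<theta> i) (pnum b z i 2) / root_det N (\<theta> i) (pnum b z i 1) \<in> cut_plane N \<epsilon>)"

definition state_sum ::
  "nat \<Rightarrow> triang \<Rightarrow> (nat \<Rightarrow> nat \<Rightarrow> nat) \<Rightarrow> cocyc \<Rightarrow> (nat \<Rightarrow> nat set \<Rightarrow> int) \<Rightarrow>
   real \<Rightarrow> (nat \<Rightarrow> real) \<Rightarrow> complex" where
  "state_sum N T b z c \<epsilon> \<theta> =
     (\<Sum>s \<in> (cells T 2 \<rightarrow>\<^sub>E {0..<int N}). \<Prod>i<ntet T. tet_tensor N T b z c \<epsilon> (\<theta> i) i s)"

definition H_value ::
  "nat \<Rightarrow> triang \<Rightarrow> (nat \<Rightarrow> nat \<Rightarrow> nat) \<Rightarrow> cocyc \<Rightarrow> (nat \<Rightarrow> nat set \<Rightarrow> int) \<Rightarrow>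
   real \<Rightarrow> (nat \<Rightarrow> real) \<Rightarrow> complex" where
  "H_value N T b z c \<epsilon> \<theta> = state_sum N T b z c \<epsilon> \<theta> / of_nat N ^ card (cells T 0)"

section \<open>The invariant\<close>

text \<open>Equality up to sign and multiplication by N-th roots of unity.\<close>

definition eq_pm_root :: "nat \<Rightarrow> complex \<Rightarrow> complex \<Rightarrow> bool" where
  "eq_pm_root N x y \<longleftrightarrow> (\<exists>u. u ^ N = 1 \<and> (x = u * y \<or> x = - (u * y)))"

definition H_values ::
  "nat \<Rightarrow> 'a oriented_space \<Rightarrow> 'a set \<Rightarrow> ('a, 'e) psl_bundle \<Rightarrow> complex set" where
  "H_values N W L \<rho> = {H_value N T b z c \<epsilon> \<theta> | T \<phi> H b z c \<epsilon> \<theta>.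
     D_triangulation W L \<rho> T \<phi> H b z \<and> integral_charge W T \<phi> H c \<and>
     admissible_cuts N T b z \<epsilon> \<theta>}"

text \<open>The invariant as an element of the complex numbers modulo \<open>eq_pm_root N\<close>, i.e. as the class
  of its values. That this is a single class is the invariance theorem, which the definition does
  not presuppose.\<close>

definition H_class ::
  "nat \<Rightarrow> 'a oriented_space \<Rightarrow> 'a set \<Rightarrow> ('a, 'e) psl_bundle \<Rightarrow> complex set" where
  "H_class N W L \<rho> = {x. \<exists>v\<in>H_values N W L \<rho>. eq_pm_root N x v}"

text \<open>\<open>x\<close> is the invariant: it is, up to the ambiguity, the value of any charged triangulation.\<close>

definition is_H ::
  "nat \<Rightarrow> 'a oriented_space \<Rightarrow> 'a set \<Rightarrow> ('a, 'e) psl_bundle \<Rightarrow> complex \<Rightarrow> bool" where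
  "is_H N W L \<rho> x \<longleftrightarrow> H_values N W L \<rho> \<noteq> {} \<and> (\<forall>v\<in>H_values N W L \<rho>. eq_pm_root N x v)"

end

theory Submission
  imports Defs "HOL-Complex_Analysis.Conformal_Mappings" "HOL-Number_Theory.Cong"
begin

text \<open>
  The identity holds exactly for state sums, before any ambiguity is divided out. Given a charged
  triangulation of \<open>(W, L, \<rho>)\<close>, keep the triangulation, the branching and the charge, reverse the signs of the
  tetrahedra, conjugate the cocycle, and reflect the auxiliary choices in the real axis (the angle
  \<open>\<epsilon>\<close> of the cuts and the determinations \<open>\<theta>\<close> of the roots change sign). The result is a charged
  triangulation of \<open>(-W, L, \<rho>\<^sup>*)\<close>, the numbers \<open>p\<^sub>j\<close> and their roots \<open>p'\<^sub>j\<close> are conjugated, and the index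
  of every tetrahedron changes sign, so that the tensors \<open>R\<close> and \<open>R_bar\<close> are exchanged.

  The point is therefore that \<open>R\<close> and \<open>R_bar\<close> are conjugate to each other (\<open>cnj_R_mat\<close>): the conjugate of
  \<open>R(x,y,z)\<close> is \<open>R_bar\<close> at the conjugate parameters, with all four indices negated modulo \<open>N\<close>. Two
  reflection formulas are behind this. For \<open>\<omega>\<close> (\<open>cnj_omega\<close>), conjugation sends \<open>\<zeta>\<^sup>j\<close> to \<open>\<zeta>\<^sup>-\<^sup>j\<close>, and the
  factors of a partial product over these are complementary to those of a partial product over the \<open>\<zeta>\<^sup>j\<close>, while
  the full product is known from \<open>x\<^sup>N + y\<^sup>N = z\<^sup>N\<close>. For \<open>g\<close> (\<open>cnj_g_cont_mult_g_cont\<close>), the product of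
  \<open>g(x)\<close> and the conjugate of \<open>g\<close> at the conjugate of \<open>x\<close> is \<open>1 + x + \<dots> + x\<^sup>N\<^sup>-\<^sup>1\<close>; this is a computation in
  the unit disc and extends to the cut plane by the identity theorem. This polynomial,
  divided by its value \<open>N\<close> at 1, is \<open>[x]\<close>: that is why the normalization of \<open>R_bar\<close> is the inverse of that of
  \<open>R\<close> times a bracket.

  Since negation modulo \<open>N\<close> permutes the states, summation gives that the state sum of the mirror
  image is the conjugate of the original one (\<open>cnj_H_value\<close>). As every charged triangulation of
  \<open>(-W, L, \<rho>\<^sup>*)\<close> is such a mirror image, the two sets of values are conjugate (\<open>cnj_H_values\<close>), and both
  claims follow because equality up to sign and \<open>N\<close>-th roots of unity is an equivalence relation
  compatible with conjugation.
\<close>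

section \<open>Roots of unity\<close>

lemma zeta_power_N: "N > 0 \<Longrightarrow> zeta N ^ N = 1"
  using complex_root_unity[of N 1] by (simp add: zeta_def mult_ac)

lemma zeta_power_eq: "zeta N ^ k = exp (2 * of_real pi * \<i> * of_nat k / of_nat N)"
  by (simp add: zeta_def exp_of_nat_mult [symmetric] mult_ac)

lemma zeta_power_inj: "N > 0 \<Longrightarrow> inj_on (\<lambda>k. zeta N ^ k) {..<N}"
  by (auto simp: inj_on_def zeta_power_eq complex_root_unity_eq)

lemma norm_zeta [simp]: "norm (zeta N) = 1"
  by (simp add: zeta_def)

lemma zeta_nonzero [simp]: "zeta N \<noteq> 0"
  by (simp add: zeta_def)

lemma cnj_zeta: "cnj (zeta N) = inverse (zeta N)"
  by (simp add: zeta_def exp_cnj exp_minus [symmetric])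

lemma zeta_powi_cong:
  assumes "N > 0" "[a = b] (mod int N)"
  shows "zeta N powi a = zeta N powi b"
proof -
  obtain k where k: "a = b + int N * k"
    using assms(2) by (metis cong_iff_lin cong_sym mult.commute)
  have "zeta N powi (int N * k) = 1"
    using zeta_power_N[OF assms(1)] by (simp add: power_int_mult)
  then show ?thesis by (simp add: k power_int_add)
qed

lemma cnj_zeta_powi: "cnj (zeta N powi a) = zeta N powi (- a)"
  by (simp add: cnj_zeta power_int_minus power_int_inverse)

lemma cnj_zeta_power:
  assumes "j \<le> N" "N > 0"
  shows "cnj (zeta N ^ j) = zeta N ^ (N - j)"
proof -
  have "zeta N ^ (N - j) * zeta N ^ j = 1"
    using assms zeta_power_N[of N] by (simp add: power_add [symmetric])
  then show ?thesis
    by (simp add: cnj_zeta power_inverse) (metis inverse_unique mult.commute power_inverse)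
qed

text \<open>The monic polynomial with the roots \<open>\<zeta>\<^sup>j\<close> is \<open>X\<^sup>N - 1\<close>; evaluate it at \<open>1 / a\<close>.\<close>

lemma prod_one_minus_zeta:
  assumes "N > 0"
  shows "(\<Prod>j<N. 1 - a * zeta N ^ j) = 1 - a ^ N"
proof (cases "a = 0")
  case False
  define P where "P = (\<Prod>j<N. [:- (zeta N ^ j), 1:])"
  define Q :: "complex poly" where "Q = Polynomial.monom 1 N - 1"
  have dP: "degree P = N" by (simp add: P_def degree_prod_eq_sum_degree)
  moreover have "lead_coeff P = 1" by (simp add: P_def lead_coeff_prod)
  ultimately have cP: "poly.coeff P N = 1" by simp
  have cQ: "poly.coeff Q N = 1" using assms by (simp add: Q_def coeff_eq_0)
  have dQ: "degree Q \<le> N" unfolding Q_def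
    by (rule degree_diff_le) (auto simp: degree_monom_le)
  have card: "card ((\<lambda>k. zeta N ^ k) ` {..<N}) = N"
    using zeta_power_inj[OF assms] by (simp add: card_image)
  have "P = Q"
  proof (rule poly_eqI_degree_lead_coeff[where n = N and A = "(\<lambda>k. zeta N ^ k) ` {..<N}"])
    fix w assume "w \<in> (\<lambda>k. zeta N ^ k) ` {..<N}"
    then obtain k where k: "k < N" "w = zeta N ^ k" by auto
    have "w ^ N = 1" using k zeta_power_N[OF assms]
      by (metis mult.commute power_mult power_one)
    moreover have "poly P w = 0" using k by (auto simp: P_def poly_prod intro!: exI[of _ k])
    ultimately show "poly P w = poly Q w" by (simp add: Q_def poly_monom)
  qed (use dP cP cQ dQ card in auto)
  then have "poly P (1 / a) = poly Q (1 / a)" by simp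
  then have e: "(\<Prod>j<N. 1 / a - zeta N ^ j) = (1 / a) ^ N - 1"
    by (simp add: P_def Q_def poly_prod poly_monom)
  have "(\<Prod>j<N. 1 - a * zeta N ^ j) = (\<Prod>j<N. a * (1 / a - zeta N ^ j))"
    using False by (intro prod.cong) (auto simp: field_simps)
  also have "\<dots> = a ^ N * ((1 / a) ^ N - 1)"
    by (simp add: prod.distrib e)
  also have "\<dots> = 1 - a ^ N" using False by (simp add: field_simps)
  finally show ?thesis .
qed (use assms in auto)

lemma prod_one_minus_zeta_nontrivial:
  assumes "N > 0" "a \<noteq> 1"
  shows "(\<Prod>j=1..<N. 1 - a * zeta N ^ j) = (\<Sum>k<N. a ^ k)"
proof -
  have "{..<N} = insert 0 {1..<N}" using assms by auto
  then have "(1 - a) * (\<Prod>j=1..<N. 1 - a * zeta N ^ j) = 1 - a ^ N"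
    using prod_one_minus_zeta[OF assms(1), of a] by simp
  also have "\<dots> = (1 - a) * (\<Sum>k<N. a ^ k)" by (rule one_diff_power_eq)
  finally show ?thesis using assms(2) by simp
qed

section \<open>The cut plane\<close>

text \<open>The cuts of \<open>g\<close> are the loci where some factor \<open>1 - x \<zeta>\<^sup>j\<close> lies on the ray
  \<open>- \<real>\<^sub>\<ge>\<^sub>0 cis \<epsilon>\<close>, i.e. on the cut of a logarithm rotated by \<open>\<epsilon>\<close>. In this form openness of the plane and
  existence of the continuation can be read off.\<close>

lemma cut_plane_iff:
  assumes "N > 0"
  shows "x \<in> cut_plane N \<epsilon> \<longleftrightarrow> (\<forall>j\<in>{1..<N}. (1 - x * zeta N ^ j) * cis (- \<epsilon>) \<notin> \<real>\<^sub>\<le>\<^sub>0)"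
proof -
  have *: "(\<exists>r\<ge>0. x = zeta N ^ k * (1 + of_real r * cis \<epsilon>)) \<longleftrightarrow>
      (1 - x * zeta N ^ (N - k)) * cis (- \<epsilon>) \<in> \<real>\<^sub>\<le>\<^sub>0" if k: "k \<in> {1..<N}" for k
  proof -
    have inv: "zeta N ^ (N - k) * zeta N ^ k = 1"
      using k zeta_power_N[OF assms] by (simp add: power_add [symmetric])
    have "x = zeta N ^ k * (1 + of_real r * cis \<epsilon>) \<longleftrightarrow>
        (1 - x * zeta N ^ (N - k)) * cis (- \<epsilon>) = - of_real r" for r
    proof -
      have "x = zeta N ^ k * (1 + of_real r * cis \<epsilon>) \<longleftrightarrow>
          x * zeta N ^ (N - k) = zeta N ^ k * (1 + of_real r * cis \<epsilon>) * zeta N ^ (N - k)" by simp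
      also have "zeta N ^ k * (1 + of_real r * cis \<epsilon>) * zeta N ^ (N - k) = 1 + of_real r * cis \<epsilon>"
        using inv by (metis (no_types, lifting) mult.assoc mult.commute mult_1)
      also have "x * zeta N ^ (N - k) = 1 + of_real r * cis \<epsilon> \<longleftrightarrow>
          (1 - x * zeta N ^ (N - k)) = - of_real r * cis \<epsilon>" by (auto simp: algebra_simps)
      also have "\<dots> \<longleftrightarrow> (1 - x * zeta N ^ (N - k)) * cis (- \<epsilon>) = - of_real r"
      proof -
        have c: "cis \<epsilon> * cis (- \<epsilon>) = 1" by (simp add: cis_mult)
        have "- of_real r * cis \<epsilon> * cis (- \<epsilon>) = - of_real r" by (simp add: mult.assoc c)
        then show ?thesis
          using mult_cancel_right[of "1 - x * zeta N ^ (N - k)" "cis (- \<epsilon>)" "- of_real r * cis \<epsilon>"]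
          by (metis cis_neq_zero)
      qed
      finally show ?thesis .
    qed
    then show ?thesis
      by (auto simp: complex_nonpos_Reals_iff complex_eq_iff) (metis minus_minus neg_0_le_iff_le)
  qed
  have "x \<in> cut_plane N \<epsilon> \<longleftrightarrow> (\<forall>k\<in>{1..<N}. (1 - x * zeta N ^ (N - k)) * cis (- \<epsilon>) \<notin> \<real>\<^sub>\<le>\<^sub>0)"
    using * unfolding cut_plane_def by blast
  also have "\<dots> \<longleftrightarrow> (\<forall>j\<in>(\<lambda>k. N - k) ` {1..<N}. (1 - x * zeta N ^ j) * cis (- \<epsilon>) \<notin> \<real>\<^sub>\<le>\<^sub>0)"
    by simp
  also have "(\<lambda>k. N - k) ` {1..<N} = {1..<N}"
    by (auto simp: image_def) (metis Suc_leI atLeastLessThan_iff diff_diff_cancel diff_less less_imp_le_nat less_le_trans One_nat_def zero_less_diff zero_less_one)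
  finally show ?thesis .
qed

lemma open_cut_plane:
  assumes "N > 0"
  shows "open (cut_plane N \<epsilon>)"
proof -
  have "cut_plane N \<epsilon> = (\<Inter>j\<in>{1..<N}. (\<lambda>x. (1 - x * zeta N ^ j) * cis (- \<epsilon>)) -` (- \<real>\<^sub>\<le>\<^sub>0))"
    using cut_plane_iff[OF assms] by auto
  also have "open \<dots>"
    by (intro open_INT open_vimage ballI) (auto intro!: continuous_intros simp: open_Compl)
  finally show ?thesis .
qed

text \<open>For \<open>\<bar>\<epsilon>\<bar> < \<pi>/2\<close> a point moving outwards along a cut strictly recedes from the origin, so that
  the cuts stay outside the unit disc, and each of them meets a circle about the origin at most once.\<close>

lemma norm_cut_ray_mono:
  assumes "\<bar>\<epsilon>\<bar> < pi / 2" "0 \<le> r" "r < r'"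
  shows "norm (1 + of_real r * cis \<epsilon>) < norm (1 + of_real r' * cis \<epsilon>)"
proof -
  have c: "cos \<epsilon> > 0" using assms(1) by (intro cos_gt_zero_pi) auto
  have "(1 + t * a)\<^sup>2 + (t * b)\<^sup>2 = 1 + 2 * (t * a) + t\<^sup>2 * (b\<^sup>2 + a\<^sup>2)" for t a b :: real
    by (simp add: power2_eq_square algebra_simps)
  from this[of _ "cos \<epsilon>" "sin \<epsilon>"]
  have e: "norm (1 + of_real t * cis \<epsilon>) ^ 2 = 1 + 2 * (t * cos \<epsilon>) + t ^ 2" for t
    by (simp add: cmod_power2)
  have "r * cos \<epsilon> < r' * cos \<epsilon>" "r ^ 2 < r' ^ 2"
    using assms c by (auto intro: power_strict_mono)
  then have "norm (1 + of_real r * cis \<epsilon>) ^ 2 < norm (1 + of_real r' * cis \<epsilon>) ^ 2"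
    unfolding e by linarith
  then show ?thesis by (rule power_less_imp_less_base) simp
qed

lemma norm_cut_ray_ge_1:
  assumes "\<bar>\<epsilon>\<bar> < pi / 2" "0 \<le> r"
  shows "norm (1 + of_real r * cis \<epsilon>) \<ge> 1"
  using norm_cut_ray_mono[OF assms(1), of 0 r] assms(2) by (cases "r = 0") auto

lemma ball_subset_cut_plane:
  assumes "\<bar>\<epsilon>\<bar> < pi / 2"
  shows "ball 0 1 \<subseteq> cut_plane N \<epsilon>"
  using norm_cut_ray_ge_1[OF assms] by (force simp: cut_plane_def norm_mult norm_power)

lemma one_in_cut_plane:
  assumes "\<bar>\<epsilon>\<bar> < pi / 2" "N > 0"
  shows "1 \<in> cut_plane N \<epsilon>"
proof (rule ccontr)
  assume "1 \<notin> cut_plane N \<epsilon>"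
  then obtain k r where k: "k \<in> {1..<N}" "0 \<le> r" "1 = zeta N ^ k * (1 + of_real r * cis \<epsilon>)"
    by (auto simp: cut_plane_def)
  from k(3) have "1 = norm (1 + of_real r * cis \<epsilon>)"
    by (metis mult_1 norm_mult norm_one norm_power norm_zeta power_one)
  then have "r = 0" using norm_cut_ray_mono[OF assms(1), of 0 r] k(2) by (cases "r = 0") auto
  then have "zeta N ^ k = zeta N ^ 0" using k(3) by simp
  then show False using inj_onD[OF zeta_power_inj[OF assms(2)], of k 0] k(1) by auto
qed

text \<open>The half-lines \<open>{u (1 + r cis \<epsilon>) | r \<ge> 0}\<close>, for \<open>u\<close> on the unit circle, foliate the exterior of the
  unit disc, and the cuts are some of these leaves. So the cut plane is the union of the disc and the
  remaining leaves, each of which touches the disc at its end point \<open>u\<close>. Radial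
  segments would not do, as they can cross the cuts.\<close>

lemma connected_cut_plane:
  assumes \<epsilon>: "\<bar>\<epsilon>\<bar> < pi / 2"
  shows "connected (cut_plane N \<epsilon>)"
proof -
  define C where "C = (\<lambda>u. (\<lambda>r. u * (1 + of_real r * cis \<epsilon>)) ` {0..})"
  define U where "U = {u. norm u = 1 \<and> u \<notin> (\<lambda>k. zeta N ^ k) ` {1..<N}}"
  have "connected (ball 0 1 \<union> C u)" if "norm u = 1" for u
  proof -
    \<comment> \<open>The half-line ends on the boundary of the disc.\<close>
    have "connected (insert u (ball 0 1))"
      by (rule connected_intermediate_closure[of "ball 0 (1::real)"]) (use that in auto)
    moreover have "connected (C u)" unfolding C_def
      by (intro connected_continuous_image continuous_intros) auto
    moreover have uC: "u \<in> C u" unfolding C_def by (rule image_eqI[of _ _ 0]) auto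
    then have "insert u (ball 0 1) \<inter> C u \<noteq> {}" by auto
    ultimately have "connected (insert u (ball 0 1) \<union> C u)" by (rule connected_Un)
    then show ?thesis using uC by (simp add: insert_absorb)
  qed
  then have "connected (ball 0 1 \<union> (\<Union>u\<in>U. ball 0 1 \<union> C u))"
  proof (cases "U = {}")
    case False
    have "connected (\<Union>u\<in>U. ball 0 1 \<union> C u)"
      by (rule connected_Union) (use \<open>\<And>u. norm u = 1 \<Longrightarrow> connected (ball 0 1 \<union> C u)\<close> in
           \<open>auto simp: U_def intro!: exI[of _ 0]\<close>)
    moreover have "ball 0 1 \<union> (\<Union>u\<in>U. ball 0 1 \<union> C u) = (\<Union>u\<in>U. ball 0 1 \<union> C u)" using False by auto
    ultimately show ?thesis by simp
  qed simp
  also have "ball 0 1 \<union> (\<Union>u\<in>U. ball 0 1 \<union> C u) = cut_plane N \<epsilon>"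
  proof (intro equalityI subsetI)
    fix x assume "x \<in> ball 0 1 \<union> (\<Union>u\<in>U. ball 0 1 \<union> C u)"
    then consider "x \<in> ball 0 1" | u where "u \<in> U" "x \<in> C u" by blast
    then show "x \<in> cut_plane N \<epsilon>"
    proof cases
      case 1 then show ?thesis using ball_subset_cut_plane[OF \<epsilon>] by blast
    next
      case 2
      then obtain r where r: "r \<ge> 0" "x = u * (1 + of_real r * cis \<epsilon>)" by (auto simp: C_def)
      show ?thesis
      proof (rule ccontr)
        assume "x \<notin> cut_plane N \<epsilon>"
        then obtain k r' where k: "k \<in> {1..<N}" "0 \<le> r'" "x = zeta N ^ k * (1 + of_real r' * cis \<epsilon>)"
          by (auto simp: cut_plane_def)
        \<comment> \<open>Leaves through different points of the circle are disjoint.\<close>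
        have "norm (1 + of_real r * cis \<epsilon>) = norm (1 + of_real r' * cis \<epsilon>)"
          using r(2) k(3) 2(1) by (auto simp: U_def norm_mult norm_power dest: arg_cong[where f = norm])
        then have "r = r'" using norm_cut_ray_mono[OF \<epsilon>, of r r'] norm_cut_ray_mono[OF \<epsilon>, of r' r] r k
          by (cases r r' rule: linorder_cases) auto
        moreover have "1 + of_real r * cis \<epsilon> \<noteq> 0" using norm_cut_ray_ge_1[OF \<epsilon> r(1)] by auto
        ultimately have "u = zeta N ^ k" using r(2) k(3) by auto
        then show False using 2(1) k(1) by (auto simp: U_def)
      qed
    qed
  next
    fix x assume x: "x \<in> cut_plane N \<epsilon>"
    show "x \<in> ball 0 1 \<union> (\<Union>u\<in>U. ball 0 1 \<union> C u)"
    proof (cases "norm x < 1")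
      case False
      \<comment> \<open>Find the leaf through \<open>x\<close> from the circle \<open>x\<close> lies on; \<open>r = 1 + \<bar>x\<bar>\<close> is already too far out.\<close>
      have "\<exists>r\<ge>0. r \<le> 1 + norm x \<and> norm (1 + complex_of_real r * cis \<epsilon>) = norm x"
      proof (rule IVT')
        have "norm (complex_of_real (1 + norm x) * cis \<epsilon>) \<le> norm (1 + complex_of_real (1 + norm x) * cis \<epsilon>) + 1"
          by (metis add.commute norm_add_leD norm_minus_commute norm_one norm_triangle_ineq4 add_diff_cancel_left' order_refl)
        then show "norm x \<le> norm (1 + complex_of_real (1 + norm x) * cis \<epsilon>)"
          unfolding norm_mult norm_of_real norm_cis by simp
      qed (use False in \<open>auto intro!: continuous_intros\<close>)
      then obtain r where r: "r \<ge> 0" "norm (1 + complex_of_real r * cis \<epsilon>) = norm x" by blast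
      define u where "u = x / (1 + of_real r * cis \<epsilon>)"
      have nz: "1 + of_real r * cis \<epsilon> \<noteq> 0" using r(2) False by auto
      then have xu: "x = u * (1 + of_real r * cis \<epsilon>)" by (simp add: u_def)
      have "norm u = 1" using r(2) False by (auto simp: u_def norm_divide)
      moreover have "u \<notin> (\<lambda>k. zeta N ^ k) ` {1..<N}"
        using x xu r(1) by (auto simp: cut_plane_def)
      ultimately show ?thesis using xu r(1) by (auto simp: U_def C_def)
    qed auto
  qed
  finally show ?thesis .
qed

lemma cnj_cut_plane:
  assumes "N > 0"
  shows "cnj x \<in> cut_plane N (- \<epsilon>) \<longleftrightarrow> x \<in> cut_plane N \<epsilon>"
proof -
  have "cnj x \<in> cut_plane N (- \<epsilon>)" if "x \<in> cut_plane N \<epsilon>" for x \<epsilon>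
  proof (rule ccontr)
    assume "cnj x \<notin> cut_plane N (- \<epsilon>)"
    then obtain k r where k: "k \<in> {1..<N}" "0 \<le> r" "cnj x = zeta N ^ k * (1 + of_real r * cis (- \<epsilon>))"
      by (auto simp: cut_plane_def)
    have "x = cnj (cnj x)" by simp
    also have "\<dots> = cnj (zeta N ^ k) * (1 + of_real r * cis \<epsilon>)"
      unfolding k(3) complex_cnj_mult by (simp add: cis_cnj)
    also have "cnj (zeta N ^ k) = zeta N ^ (N - k)" using k assms by (intro cnj_zeta_power) auto
    finally have "x \<notin> cut_plane N \<epsilon>"
      using k(1,2) by (auto simp: cut_plane_def intro!: exI[of _ "N - k"] exI[of _ r])
    with that show False by simp
  qed
  from this[of x \<epsilon>] this[of "cnj x" "- \<epsilon>"] show ?thesis by auto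
qed

section \<open>The reflection formula for the analytic continuation of g\<close>

text \<open>The continuation is the product of the powers formed with a logarithm whose cut is rotated by
  \<open>\<epsilon>\<close>. In the unit disc the factors \<open>1 - x \<zeta>\<^sup>j\<close> have positive real part, where this logarithm agrees
  with the principal one because \<open>\<bar>\<epsilon>\<bar> < \<pi>/2\<close>.\<close>

lemma g_cont_exists:
  assumes "\<bar>\<epsilon>\<bar> < pi / 2" "N > 0"
  shows "\<exists>G. G holomorphic_on cut_plane N \<epsilon> \<and>
     (\<forall>x\<in>ball 0 1. G x = (\<Prod>j=1..<N. (1 - x * zeta N ^ j) powr (of_nat j / of_nat N)))"
proof (intro exI conjI ballI)
  let ?L = "\<lambda>j x. Ln ((1 - x * zeta N ^ j) * cis (- \<epsilon>)) + \<i> * of_real \<epsilon>"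
  let ?G = "\<lambda>x. \<Prod>j=1..<N. exp (of_nat j / of_nat N * ?L j x)"
  show "?G holomorphic_on cut_plane N \<epsilon>"
    using cut_plane_iff[OF assms(2)] assms(2) by (intro holomorphic_intros) auto
  fix x :: complex assume x: "x \<in> ball 0 1"
  show "?G x = (\<Prod>j=1..<N. (1 - x * zeta N ^ j) powr (of_nat j / of_nat N))"
  proof (intro prod.cong refl)
    fix j
    let ?w = "1 - x * zeta N ^ j"
    have "norm (x * zeta N ^ j) < 1" using x by (simp add: norm_mult norm_power)
    then have "Re ?w > 0" using complex_Re_le_cmod[of "x * zeta N ^ j"] by simp
    then have im: "\<bar>Im (Ln ?w)\<bar> < pi / 2" and nz: "?w \<noteq> 0"
      using Re_Ln_pos_lt_imp by (blast, force)
    have "Ln (?w * cis (- \<epsilon>)) = Ln ?w - \<i> * of_real \<epsilon>"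
    proof (rule Ln_unique)
      show "exp (Ln ?w - \<i> * of_real \<epsilon>) = ?w * cis (- \<epsilon>)"
        using nz by (simp add: exp_diff cis_conv_exp exp_minus field_simps)
    qed (use im assms(1) in auto)
    then show "exp (of_nat j / of_nat N * ?L j x) = ?w powr (of_nat j / of_nat N)"
      using nz by (simp add: powr_def)
  qed
qed

lemma
  assumes "\<bar>\<epsilon>\<bar> < pi / 2" "N > 0"
  shows g_cont_holomorphic: "g_cont N \<epsilon> holomorphic_on cut_plane N \<epsilon>"
    and g_cont_ball: "\<And>x. norm x < 1 \<Longrightarrow>
      g_cont N \<epsilon> x = (\<Prod>j=1..<N. (1 - x * zeta N ^ j) powr (of_nat j / of_nat N))"
  using someI_ex[OF g_cont_exists[OF assms]] unfolding g_cont_def by auto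

text \<open>The reflection formula for \<open>g\<close>. Conjugation replaces \<open>\<zeta>\<^sup>j\<close> by \<open>\<zeta>\<^sup>N\<^sup>-\<^sup>j\<close>, hence the exponent \<open>j/N\<close> of the
  factor \<open>1 - x \<zeta>\<^sup>j\<close> by \<open>(N - j)/N\<close>. So in the unit disc the two exponents add up to 1, and the
  product is \<open>(1 - x\<^sup>N)/(1 - x)\<close>. Both sides are holomorphic on the connected cut plane. Writing the
  quotient as a geometric sum includes the point \<open>x = 1\<close>, where \<open>g\<close> is evaluated to normalize \<open>h\<close>.\<close>

lemma cnj_g_cont_mult_g_cont:
  assumes \<epsilon>: "\<bar>\<epsilon>\<bar> < pi / 2" and N: "N > 0" and x: "x \<in> cut_plane N \<epsilon>"
  shows "cnj (g_cont N (- \<epsilon>) (cnj x)) * g_cont N \<epsilon> x = (\<Sum>k<N. x ^ k)"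
proof (rule analytic_continuation_open[of "ball 0 1" "cut_plane N \<epsilon>"
      "\<lambda>x. cnj (g_cont N (- \<epsilon>) (cnj x)) * g_cont N \<epsilon> x" "\<lambda>x. \<Sum>k<N. x ^ k"])
  have \<epsilon>': "\<bar>- \<epsilon>\<bar> < pi / 2" using \<epsilon> by simp
  have "g_cont N (- \<epsilon>) holomorphic_on cnj ` cut_plane N \<epsilon>"
    by (rule holomorphic_on_subset[OF g_cont_holomorphic[OF \<epsilon>' N]]) (use cnj_cut_plane[OF N] in auto)
  from holomorphic_on_compose_cnj_cnj[OF this open_cut_plane[OF N]]
  show "(\<lambda>x. cnj (g_cont N (- \<epsilon>) (cnj x)) * g_cont N \<epsilon> x) holomorphic_on cut_plane N \<epsilon>"
    by (intro holomorphic_on_mult g_cont_holomorphic \<epsilon> N) (simp add: o_def)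
  fix w :: complex assume w: "w \<in> ball 0 1"
  have pos: "Re (1 - w * zeta N ^ j) > 0" for j
  proof -
    have "norm (w * zeta N ^ j) < 1" using w by (simp add: norm_mult norm_power)
    then show ?thesis using complex_Re_le_cmod[of "w * zeta N ^ j"] by simp
  qed
  have cp: "cnj (cnj v powr (of_nat a / of_nat b)) = v powr (of_nat a / of_nat b)"
    if "Re v > 0" for v a b
    using cnj_powr[of "cnj v" "of_nat a / of_nat b"] that by simp
  have "cnj (g_cont N (- \<epsilon>) (cnj w)) =
      (\<Prod>j=1..<N. cnj ((1 - cnj w * zeta N ^ j) powr (of_nat j / of_nat N)))"
    using w by (subst g_cont_ball[OF \<epsilon>' N]) auto
  also have "\<dots> = (\<Prod>j=1..<N. (1 - w * zeta N ^ (N - j)) powr (of_nat j / of_nat N))"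
  proof (intro prod.cong refl)
    fix j assume j: "j \<in> {1..<N}"
    then have c: "cnj (1 - w * zeta N ^ (N - j)) = 1 - cnj w * zeta N ^ j"
      using cnj_zeta_power[of "N - j" N] N by simp
    have "cnj ((1 - cnj w * zeta N ^ j) powr (of_nat j / of_nat N)) =
        cnj (cnj (1 - w * zeta N ^ (N - j)) powr (of_nat j / of_nat N))" by (simp only: c)
    also have "\<dots> = (1 - w * zeta N ^ (N - j)) powr (of_nat j / of_nat N)"
      by (rule cp[OF pos])
    finally show "cnj ((1 - cnj w * zeta N ^ j) powr (of_nat j / of_nat N)) =
        (1 - w * zeta N ^ (N - j)) powr (of_nat j / of_nat N)" .
  qed
  also have "\<dots> = (\<Prod>j=1..<N. (1 - w * zeta N ^ j) powr (of_nat (N - j) / of_nat N))"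
    by (rule prod.reindex_bij_witness[of _ "\<lambda>j. N - j" "\<lambda>j. N - j"]) auto
  finally have "cnj (g_cont N (- \<epsilon>) (cnj w)) * g_cont N \<epsilon> w =
     (\<Prod>j=1..<N. (1 - w * zeta N ^ j) powr (of_nat (N - j) / of_nat N) *
        (1 - w * zeta N ^ j) powr (of_nat j / of_nat N))"
    using w by (simp add: g_cont_ball[OF \<epsilon> N] prod.distrib)
  also have "\<dots> = (\<Prod>j=1..<N. 1 - w * zeta N ^ j)"
  proof (intro prod.cong refl)
    fix j assume j: "j \<in> {1..<N}"
    have nz: "1 - w * zeta N ^ j \<noteq> 0" using pos[of j] by force
    have "of_nat (N - j) / of_nat N + of_nat j / of_nat N = (1::complex)"
      using j N by (simp add: add_divide_distrib [symmetric] of_nat_diff)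
    then show "(1 - w * zeta N ^ j) powr (of_nat (N - j) / of_nat N) *
        (1 - w * zeta N ^ j) powr (of_nat j / of_nat N) = 1 - w * zeta N ^ j"
      using nz by (simp add: powr_add [symmetric])
  qed
  also have "\<dots> = (\<Sum>k<N. w ^ k)"
    using w by (intro prod_one_minus_zeta_nontrivial N) auto
  finally show "cnj (g_cont N (- \<epsilon>) (cnj w)) * g_cont N \<epsilon> w = (\<Sum>k<N. w ^ k)" .
next
  show "ball 0 1 \<subseteq> cut_plane N \<epsilon>" by (rule ball_subset_cut_plane[OF \<epsilon>])
qed (use \<epsilon> N x in \<open>auto intro!: open_cut_plane connected_cut_plane holomorphic_intros\<close>)

section \<open>Conjugation of R-matrices\<close>

text \<open>From the reflection formula for \<open>g\<close>, at \<open>u\<close> and at 1. With \<open>N = 2p + 1\<close> the two factors \<open>u\<^sup>-\<^sup>p\<close> of the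
  functions \<open>h\<close> combine to \<open>u\<^sup>1\<^sup>-\<^sup>N\<close>, which turns \<open>[u]\<close> into \<open>[1/u]\<close>.\<close>

lemma cnj_h_fun:
  assumes \<epsilon>: "\<bar>\<epsilon>\<bar> < pi / 2" and N: "odd N" and u: "u \<in> cut_plane N \<epsilon>" "u \<noteq> 0" "u ^ N \<noteq> 1"
  shows "cnj (h_fun N \<epsilon> u) = bracket N (1 / cnj u) / h_fun N (- \<epsilon>) (cnj u)"
proof -
  define v where "v = cnj u"
  define p where "p = (N - 1) div 2"
  have N0: "N > 0" using N by (rule odd_pos)
  have Np: "N = Suc (p + p)" using N unfolding p_def by presburger
  have \<epsilon>': "\<bar>- \<epsilon>\<bar> < pi / 2" using \<epsilon> by simp
  have v: "v \<in> cut_plane N (- \<epsilon>)" "v \<noteq> 0" "v ^ N \<noteq> 1"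
    using u cnj_cut_plane[OF N0] unfolding v_def
    by (auto simp flip: complex_cnj_power)
  have vu: "cnj v = u" by (simp add: v_def)
  have "v \<noteq> 1" using v(3) by auto
  have g: "cnj (g_cont N \<epsilon> u) * g_cont N (- \<epsilon>) v = (1 - v ^ N) / (1 - v)"
    using cnj_g_cont_mult_g_cont[OF \<epsilon>' N0 v(1)] one_diff_power_eq[of v N] \<open>v \<noteq> 1\<close>
    by (simp add: vu)
  have g1: "cnj (g_cont N \<epsilon> 1) * g_cont N (- \<epsilon>) 1 = of_nat N"
    using cnj_g_cont_mult_g_cont[OF \<epsilon>' N0 one_in_cut_plane[OF \<epsilon>' N0]] by simp
  have nz: "g_cont N (- \<epsilon>) v \<noteq> 0" "g_cont N (- \<epsilon>) 1 \<noteq> 0" "cnj (g_cont N \<epsilon> 1) \<noteq> 0"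
    using g g1 v(3) \<open>v \<noteq> 1\<close> N0 by auto
  have gu: "cnj (g_cont N \<epsilon> u) = (1 - v ^ N) / ((1 - v) * g_cont N (- \<epsilon>) v)"
    using g nz \<open>v \<noteq> 1\<close> by (simp add: field_simps)
  have gv: "cnj (g_cont N \<epsilon> 1) = of_nat N / g_cont N (- \<epsilon>) 1"
    using g1 nz by (simp add: field_simps)
  have bN: "bracket N (1 / v) = (1 - v ^ N) / (of_nat N * (1 - v) * (v ^ p * v ^ p))"
  proof -
    have "v ^ N = v * (v ^ p * v ^ p)" by (simp add: Np power_add)
    then show ?thesis
      using v(2) \<open>v \<noteq> 1\<close> N0 by (simp add: bracket_def power_divide divide_simps) (simp add: algebra_simps)
  qed
  have "cnj (h_fun N \<epsilon> u) = cnj (g_cont N \<epsilon> u) / (v ^ p * cnj (g_cont N \<epsilon> 1))"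
    by (simp add: h_fun_def p_def v_def)
  also have "\<dots> = bracket N (1 / v) / h_fun N (- \<epsilon>) v"
    unfolding gu gv bN h_fun_def p_def [symmetric] using nz v(2) N0 \<open>v \<noteq> 1\<close> by (simp add: field_simps)
  finally show ?thesis by (simp add: v_def)
qed

lemma omega_cong:
  assumes "[m = n] (mod int N)"
  shows "omega N x y z m = omega N x y z n"
  using assms by (simp add: omega_def cong_def)

text \<open>The factors \<open>1 - a \<zeta>\<^sup>-\<^sup>j\<close>, \<open>1 \<le> j \<le> m\<close>, of the conjugate and the factors \<open>1 - a \<zeta>\<^sup>i\<close>, \<open>0 \<le> i < N - m\<close>, of
  the \<open>\<omega>\<close> at the negated argument together involve each \<open>N\<close>-th root of unity once; their
  product is \<open>1 - a\<^sup>N = b\<^sup>N\<close> by the Fermat relation, which the \<open>N\<close> numerators \<open>b\<close> cancel. The division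
  of \<open>x\<close> by \<open>\<zeta>\<close> accounts for the shift from \<open>1 \<le> j\<close> to \<open>0 \<le> i\<close>.\<close>

lemma cnj_omega:
  assumes N: "N > 0" and xyz: "x ^ N + y ^ N = z ^ N" "y \<noteq> 0" "z \<noteq> 0"
  shows "cnj (omega N x y z n) = 1 / omega N (cnj x / zeta N) (cnj y) (cnj z) (- n)"
proof -
  define a b where "a = cnj x / cnj z" and "b = cnj y / cnj z"
  define m where "m = nat (n mod int N)"
  have mN: "m < N" using N by (simp add: m_def nat_less_iff)
  have b0: "b \<noteq> 0" using xyz by (simp add: b_def)
  have "a ^ N + b ^ N = cnj (x ^ N + y ^ N) / cnj z ^ N"
    by (simp add: a_def b_def power_divide add_divide_distrib)
  also have "\<dots> = 1" using xyz by simp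
  finally have ab: "1 - a ^ N = b ^ N" by (simp add: algebra_simps)
  have prod: "(\<Prod>i<N. 1 - a * zeta N ^ i) = b ^ N" using prod_one_minus_zeta[OF N] ab by simp
  have l: "cnj (omega N x y z n) = (\<Prod>j=1..m. b / (1 - a * zeta N ^ (N - j)))"
  proof -
    have "cnj (omega N x y z n) = (\<Prod>j=1..m. b / (1 - a * cnj (zeta N ^ j)))"
      by (simp add: omega_def m_def a_def b_def)
    also have "\<dots> = (\<Prod>j=1..m. b / (1 - a * zeta N ^ (N - j)))"
      using mN N by (intro prod.cong refl) (subst cnj_zeta_power, auto)
    finally show ?thesis .
  qed
  have r: "omega N (cnj x / zeta N) (cnj y) (cnj z) (- n) =
     (\<Prod>j=1..nat ((- n) mod int N). b / (1 - a * zeta N ^ (j - 1)))"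
    unfolding omega_def b_def[symmetric]
  proof (intro prod.cong refl)
    fix j assume "j \<in> {1..nat ((- n) mod int N)}"
    then obtain i where "j = Suc i" by (metis atLeastAtMost_iff One_nat_def Suc_le_D)
    then show "b / (1 - cnj x / zeta N / cnj z * zeta N ^ j) = b / (1 - a * zeta N ^ (j - 1))"
      by (simp add: a_def)
  qed
  \<comment> \<open>If \<open>N\<close> divides \<open>n\<close> both products are empty, since the length \<open>N - m\<close> is reduced mod \<open>N\<close>.\<close>
  show ?thesis
  proof (cases "m = 0")
    case True
    then have "n mod int N = 0" using N by (simp add: m_def) (metis nat_0_iff mod_pos_pos_trivial order_antisym pos_mod_sign of_nat_0_less_iff)
    then have "(- n) mod int N = 0" by (simp add: mod_minus_eq zmod_zminus1_eq_if)
    then show ?thesis unfolding l r using True by simp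
  next
    case False
    then have "n mod int N \<noteq> 0" by (auto simp: m_def)
    then have "(- n) mod int N = int N - n mod int N" by (simp add: zmod_zminus1_eq_if)
    moreover have "int m = n mod int N" using N by (simp add: m_def)
    ultimately have k: "nat ((- n) mod int N) = N - m" using mN by linarith
    have 1: "(\<Prod>j=1..m. b / (1 - a * zeta N ^ (N - j))) = (\<Prod>i\<in>{N-m..<N}. b / (1 - a * zeta N ^ i))"
      using mN by (intro prod.reindex_bij_witness[of _ "\<lambda>i. N - i" "\<lambda>i. N - i"]) auto
    have 2: "(\<Prod>j=1..N-m. b / (1 - a * zeta N ^ (j - 1))) = (\<Prod>i\<in>{..<N-m}. b / (1 - a * zeta N ^ i))"
      by (intro prod.reindex_bij_witness[of _ "\<lambda>i. Suc i" "\<lambda>i. i - 1"]) auto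
    have "(\<Prod>i\<in>{N-m..<N}. b / (1 - a * zeta N ^ i)) * (\<Prod>i\<in>{..<N-m}. b / (1 - a * zeta N ^ i))
        = (\<Prod>i\<in>{N-m..<N} \<union> {..<N-m}. b / (1 - a * zeta N ^ i))"
      by (rule prod.union_disjoint [symmetric]) auto
    also have "{N-m..<N} \<union> {..<N-m} = {..<N}" by auto
    also have "(\<Prod>i<N. b / (1 - a * zeta N ^ i)) = 1"
      using prod b0 by (simp add: prod_dividef)
    finally have "cnj (omega N x y z n) * omega N (cnj x / zeta N) (cnj y) (cnj z) (- n) = 1"
      unfolding l r k 1 2 .
    then show ?thesis by (metis nonzero_eq_divide_eq mult_zero_right zero_neq_one)
  qed
qed

text \<open>Conjugation turns the exponent of \<open>\<zeta>\<close> into its negative, which is the exponent in \<open>R_bar\<close>; that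
  exponent is even in the indices, whereas the \<open>\<omega>\<close> factor requires all indices to be negated. The
  indices matter modulo \<open>N\<close> only, hence the congruences.\<close>

lemma cnj_R_mat:
  assumes \<epsilon>: "\<bar>\<epsilon>\<bar> < pi / 2" and N: "odd N"
    and xyz: "x ^ N + y ^ N = z ^ N" "x \<noteq> 0" "y \<noteq> 0" "z \<noteq> 0" and u: "z / x \<in> cut_plane N \<epsilon>"
    and c: "[\<alpha>' = - \<alpha>] (mod int N)" "[\<beta>' = - \<beta>] (mod int N)" "[\<gamma>' = - \<gamma>] (mod int N)"
      "[\<delta>' = - \<delta>] (mod int N)"
  shows "cnj (R_mat N \<epsilon> x y z \<alpha> \<beta> \<gamma> \<delta>) =
     R_bar N (- \<epsilon>) (cnj x) (cnj y) (cnj z) \<alpha>' \<beta>' \<gamma>' \<delta>'"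
proof -
  have N0: "N > 0" using N by (rule odd_pos)
  have "(z / x) ^ N \<noteq> 1"
  proof
    assume "(z / x) ^ N = 1"
    then have "z ^ N = x ^ N" using xyz(2) by (simp add: power_divide)
    then show False using xyz by simp
  qed
  then have h: "cnj (h_fun N \<epsilon> (z / x)) =
      bracket N (cnj x / cnj z) / h_fun N (- \<epsilon>) (cnj z / cnj x)"
    using cnj_h_fun[OF \<epsilon> N u] xyz by simp
  have "[- \<alpha>' * \<delta>' - half N * \<alpha>'^2 = - (- \<alpha>) * (- \<delta>) - half N * (- \<alpha>)^2] (mod int N)"
    using c by (intro cong_diff cong_mult cong_pow cong_minus_minus_iff[THEN iffD2] cong_refl)
  from zeta_powi_cong[OF N0 this]
  have e: "cnj (zeta N powi (\<alpha> * \<delta> + half N * \<alpha>^2)) =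
      zeta N powi (- \<alpha>' * \<delta>' - half N * \<alpha>'^2)"
    unfolding cnj_zeta_powi by simp
  have "[\<gamma>' - \<alpha>' = - \<gamma> - - \<alpha>] (mod int N)" using c by (intro cong_diff)
  then have w: "cnj (omega N x y z (\<gamma> - \<alpha>)) =
      1 / omega N (cnj x / zeta N) (cnj y) (cnj z) (\<gamma>' - \<alpha>')"
    using cnj_omega[OF N0 xyz(1,3,4), of "\<gamma> - \<alpha>"] omega_cong by simp
  have "[\<gamma>' + \<delta>' - \<beta>' = - \<gamma> + - \<delta> - - \<beta>] (mod int N)" using c by (intro cong_diff cong_add)
  then have "int N dvd \<gamma>' + \<delta>' - \<beta>' \<longleftrightarrow> int N dvd - (\<gamma> + \<delta> - \<beta>)"
    by (metis cong_dvd_iff add_uminus_conv_diff minus_add_distrib)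
  then have k: "cnj (kron N (\<gamma> + \<delta> - \<beta>)) = kron N (\<gamma>' + \<delta>' - \<beta>')"
    unfolding dvd_minus_iff by (simp add: kron_def)
  show ?thesis unfolding R_mat_def R_bar_def complex_cnj_mult h e w k by simp
qed

text \<open>Off the cut, reflection in the real axis exchanges the determinations \<open>\<theta>\<close> and \<open>- \<theta>\<close>.\<close>

lemma cnj_root_det:
  assumes "x * cis (- \<theta>) \<notin> \<real>\<^sub>\<le>\<^sub>0"
  shows "cnj (root_det N \<theta> x) = root_det N (- \<theta>) (cnj x)"
  using assms by (simp add: root_det_def exp_cnj cnj_Ln cis_cnj)

lemma root_det_power:
  assumes "x \<noteq> 0" "N > 0"
  shows "root_det N \<theta> x ^ N = x"
proof -
  have "root_det N \<theta> x ^ N = exp (Ln (x * cis (- \<theta>)) + \<i> * of_real \<theta>)"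
    using assms by (simp add: root_det_def exp_of_nat_mult [symmetric])
  also have "\<dots> = x * (cis (- \<theta>) * cis \<theta>)"
    using assms by (simp add: exp_add cis_conv_exp mult_ac)
  finally show ?thesis by (simp add: cis_mult)
qed

lemma root_det_nonzero [simp]: "root_det N \<theta> x \<noteq> 0"
  by (simp add: root_det_def)

section \<open>Complex conjugation on PSL(2,C)\<close>

definition mat_cnj :: "complex^2^2 \<Rightarrow> complex^2^2" where
  "mat_cnj A = (\<chi> i j. cnj (A$i$j))"

lemma psl_cnj_eq_image: "psl_cnj g = mat_cnj ` g"
  by (simp add: psl_cnj_def mat_cnj_def [abs_def])

lemma mat_cnj_nth [simp]: "mat_cnj A $ i $ j = cnj (A $ i $ j)"
  by (simp add: mat_cnj_def)

lemma mat_cnj_mat_cnj [simp]: "mat_cnj (mat_cnj A) = A"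
  by (simp add: vec_eq_iff)

lemma mat_cnj_mult: "mat_cnj (A ** B) = mat_cnj A ** mat_cnj B"
  by (simp add: vec_eq_iff matrix_matrix_mult_def)

lemma mat_cnj_uminus [simp]: "mat_cnj (- A) = - mat_cnj A"
  by (simp add: vec_eq_iff)

lemma mat_cnj_mat_1 [simp]: "mat_cnj (mat 1) = mat 1"
  by (simp add: vec_eq_iff mat_def)

lemma det_mat_cnj: "det (mat_cnj A) = cnj (det A)"
  by (simp add: det_2)

lemma SL2C_simps [simp]:
  "A \<in> carrier SL2C \<longleftrightarrow> det A = 1" "monoid.mult SL2C = (**)" "one SL2C = mat 1"
  by (simp_all add: SL2C_def)

lemma group_SL2C: "group SL2C"
proof (rule groupI)
  fix A assume "A \<in> carrier SL2C"
  then have d: "A$1$1 * A$2$2 - A$1$2 * A$2$1 = 1" by (simp add: det_2)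
  define B :: "complex^2^2" where
    "B = (\<chi> i j. if i = j then (if i = 1 then A$2$2 else A$1$1) else - A$i$j)"
  have "B ** A = mat 1" "det B = 1"
    using d by (auto simp: B_def vec_eq_iff matrix_matrix_mult_def mat_def forall_2 sum_2 det_2 algebra_simps)
  then show "\<exists>B\<in>carrier SL2C. B \<otimes>\<^bsub>SL2C\<^esub> A = \<one>\<^bsub>SL2C\<^esub>" by auto
qed (simp_all add: det_mul matrix_mul_assoc)

lemma minus_matrix_mult [simp]:
  "(- A) ** B = - (A ** B)" "A ** (- B) = - (A ** B)" for A B :: "complex^2^2"
  by (simp_all add: vec_eq_iff matrix_matrix_mult_def sum_negf)

lemma det_minus_2 [simp]: "det (- A) = det A" for A :: "complex^2^2"
  by (simp add: det_2)

lemma center_normal: "{mat 1, - mat 1} \<lhd> SL2C"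
proof (rule group.normal_invI[OF group_SL2C])
  interpret SL: group SL2C by (rule group_SL2C)
  have "inv\<^bsub>SL2C\<^esub> (- mat 1) = - mat 1" by (rule SL.inv_equality) auto
  then show "subgroup {mat 1, - mat 1} SL2C"
    using SL.inv_one by unfold_locales (auto)
  fix A h :: "complex^2^2" assume A: "A \<in> carrier SL2C" and h: "h \<in> {mat 1, - mat 1}"
  have "A ** inv\<^bsub>SL2C\<^esub> A = mat 1" using SL.r_inv[OF A] by simp
  then show "A \<otimes>\<^bsub>SL2C\<^esub> h \<otimes>\<^bsub>SL2C\<^esub> inv\<^bsub>SL2C\<^esub> A \<in> {mat 1, - mat 1}"
    using h by auto
qed

text \<open>That \<open>PSL(2,\<complex>)\<close> is a group serves to show that conjugation commutes with inversion, which is a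
  definite description and behaves well only when inverses are unique.\<close>

lemma group_PSL2C: "group PSL2C"
  unfolding PSL2C_def by (rule normal.factorgroup_is_group[OF center_normal])

lemma carrier_PSL2C: "g \<in> carrier PSL2C \<longleftrightarrow> (\<exists>A. det A = 1 \<and> g = {A, - A})"
proof -
  have "{mat 1, - mat 1} #>\<^bsub>SL2C\<^esub> A = {A, - A}" for A
    by (auto simp: r_coset_def)
  then show ?thesis by (auto simp: PSL2C_def carrier_FactGroup)
qed

lemma psl_cnj_psl_cnj [simp]: "psl_cnj (psl_cnj g) = g"
  by (simp add: psl_cnj_eq_image image_image)

lemma psl_cnj_closed [simp]: "psl_cnj g \<in> carrier PSL2C \<longleftrightarrow> g \<in> carrier PSL2C"
proof -
  have "psl_cnj g \<in> carrier PSL2C" if "g \<in> carrier PSL2C" for g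
  proof -
    obtain A where A: "det A = 1" "g = {A, - A}" using \<open>g \<in> carrier PSL2C\<close> carrier_PSL2C by auto
    then have "det (mat_cnj A) = 1" "psl_cnj g = {mat_cnj A, - mat_cnj A}"
      by (simp_all add: det_mat_cnj psl_cnj_eq_image)
    then show ?thesis using carrier_PSL2C by blast
  qed
  from this[of g] this[of "psl_cnj g"] show ?thesis by auto
qed

lemma psl_cnj_mult: "psl_cnj (g \<otimes>\<^bsub>PSL2C\<^esub> h) = psl_cnj g \<otimes>\<^bsub>PSL2C\<^esub> psl_cnj h"
  by (simp add: PSL2C_def set_mult_def psl_cnj_eq_image image_UN mat_cnj_mult)

lemma psl_cnj_one: "psl_cnj \<one>\<^bsub>PSL2C\<^esub> = \<one>\<^bsub>PSL2C\<^esub>"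
  by (simp add: PSL2C_def psl_cnj_eq_image)

lemma psl_cnj_inv:
  assumes "g \<in> carrier PSL2C"
  shows "psl_cnj (inv\<^bsub>PSL2C\<^esub> g) = inv\<^bsub>PSL2C\<^esub> (psl_cnj g)"
proof (rule sym, rule group.inv_equality[OF group_PSL2C])
  show "psl_cnj (inv\<^bsub>PSL2C\<^esub> g) \<otimes>\<^bsub>PSL2C\<^esub> psl_cnj g = \<one>\<^bsub>PSL2C\<^esub>"
    using assms by (metis group.l_inv group_PSL2C psl_cnj_mult psl_cnj_one)
qed (use assms group.inv_closed[OF group_PSL2C] in auto)

lemma moebius_CP1_minus: "moebius_CP1 (- A) w = moebius_CP1 A w"
proof (cases w)
  case (Some u)
  have "(- A) $ 1 $ 1 * u + (- A) $ 1 $ 2 = - (A $ 1 $ 1 * u + A $ 1 $ 2)"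
    and "(- A) $ 2 $ 1 * u + (- A) $ 2 $ 2 = - (A $ 2 $ 1 * u + A $ 2 $ 2)" by simp_all
  then show ?thesis
    by (simp only: Some moebius_CP1_def moebius_def option.case neg_equal_0_iff_equal minus_divide_divide)
qed (simp add: moebius_CP1_def)

lemma moebius_CP1_cnj: "moebius_CP1 (mat_cnj A) (map_option cnj w) = map_option cnj (moebius_CP1 A w)"
proof (cases w)
  case (Some u)
  have "cnj (A $ 2 $ 1) * cnj u + cnj (A $ 2 $ 2) = 0 \<longleftrightarrow> A $ 2 $ 1 * u + A $ 2 $ 2 = 0"
    by (metis complex_cnj_add complex_cnj_mult complex_cnj_zero_iff)
  then show ?thesis using Some by (simp add: moebius_CP1_def moebius_def)
qed (simp add: moebius_CP1_def)

lemma psl_act_eq: "psl_act {A, - A} = moebius_CP1 A"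
proof -
  have "(SOME B. B \<in> {A, - A}) \<in> {A, - A}" by (rule someI[of _ A]) simp
  then show ?thesis unfolding psl_act_def using moebius_CP1_minus by (auto simp: fun_eq_iff)
qed

lemma psl_act_cnj:
  assumes "g \<in> carrier PSL2C"
  shows "psl_act (psl_cnj g) (map_option cnj w) = map_option cnj (psl_act g w)"
proof -
  obtain A where A: "g = {A, - A}" using assms carrier_PSL2C by auto
  then show ?thesis by (simp add: psl_cnj_eq_image psl_act_eq moebius_CP1_cnj)
qed

section \<open>Mirror images of triangulations\<close>

text \<open>The same singular triangulation, read in the manifold with the opposite orientation.\<close>

definition mirror :: "triang \<Rightarrow> triang" where
  "mirror T = T\<lparr>ori := (\<lambda>i. - ori T i)\<rparr>"

lemma mirror_simps [simp]:
  "ntet (mirror T) = ntet T" "glue (mirror T) = glue T" "ori (mirror T) i = - ori T i"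
  "mirror (mirror T) = T"
  by (simp_all add: mirror_def)

lemma cells_mirror [simp]:
  "point_glue (mirror T) = point_glue T" "cell_of (mirror T) = cell_of T" "cells (mirror T) = cells T"
  "quasi_regular (mirror T) = quasi_regular T" "branching (mirror T) = branching T"
  by (simp_all add: fun_eq_iff point_glue_def cell_of_def simplex_glue_def cells_def quasi_regular_def
      branching_def)

lemma gluing_ok_mirror [simp]: "gluing_ok (mirror T) = gluing_ok T"
proof -
  have "- x \<in> {1, -1} \<longleftrightarrow> x \<in> {1, -1}" for x :: int by auto
  then show ?thesis by (simp only: gluing_ok_def mirror_simps)
qed

lemma underlying_opposite [simp]: "underlying (opposite W) = underlying W"
  by (simp add: opposite_def)

text \<open>Both the orientation of the manifold and the signs of the tetrahedra are reversed, so the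
  condition relating them at interior points persists; in one of the two cases this uses that
  inversion in the local homology group is an involution on the orientation class.\<close>

lemma triangulates_mirror:
  assumes "is_orientation (underlying W) (orientation W)"
  shows "triangulates (opposite W) (mirror T) \<phi> \<longleftrightarrow> triangulates W T \<phi>"
proof -
  let ?X = "underlying W"
  have "(if - ori T i = 1 then orientation (opposite W) (\<phi> i x)
         else inv\<^bsub>local_homology ?X {\<phi> i x}\<^esub> (orientation (opposite W) (\<phi> i x))) =
        (if ori T i = 1 then orientation W (\<phi> i x)
         else inv\<^bsub>local_homology ?X {\<phi> i x}\<^esub> (orientation W (\<phi> i x)))"
    if g: "gluing_ok T" and i: "i < ntet T" and x: "x \<in> open_cell {..3}"
      and q: "quotient_map (sum_topology (\<lambda>i. simplex3) {..<ntet T}) ?X (\<lambda>(i, x). \<phi> i x)" for i x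
  proof -
    have "(i, x) \<in> topspace (sum_topology (\<lambda>i. simplex3) {..<ntet T})"
      using i x by (auto simp: topspace_sum_topology open_cell_def)
    then have "\<phi> i x \<in> topspace ?X" using q by (auto simp: quotient_map_def)
    then have c: "orientation W (\<phi> i x) \<in> carrier (local_homology ?X {\<phi> i x})"
      using assms by (simp add: is_orientation_def)
    interpret group "local_homology ?X {\<phi> i x}" by simp
    have "ori T i = 1 \<or> ori T i = - 1" using g i by (auto simp: gluing_ok_def)
    then show ?thesis using inv_inv[OF c] by (auto simp: opposite_def)
  qed
  then show ?thesis
    unfolding triangulates_def gluing_ok_mirror mirror_simps cells_mirror underlying_opposite
    by (intro conj_cong refl) auto
qed

lemma integral_charge_mirror:
  "integral_charge (opposite W) (mirror T) \<phi> H c \<longleftrightarrow> integral_charge W T \<phi> H c"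
  by (simp add: integral_charge_def transverse_curve_def)

section \<open>Conjugate cocycles and their idealizations\<close>

definition cocyc_cnj :: "cocyc \<Rightarrow> cocyc" where
  "cocyc_cnj z = (\<lambda>i a a'. psl_cnj (z i a a'))"

lemma cocyc_cnj_cocyc_cnj [simp]: "cocyc_cnj (cocyc_cnj z) = z"
  by (simp add: cocyc_cnj_def)

text \<open>In the conjugate bundle the conjugate of \<open>g\<close> acts as \<open>g\<close> did, so the same points in the fibres and the
  same lifted edges serve for both cocycles.\<close>

lemma represents_mirror:
  "represents (mirror T) \<phi> (cocyc_cnj z) (conj_bundle \<rho>) \<longleftrightarrow> represents T \<phi> z \<rho>"
  by (simp add: represents_def conj_bundle_def cocyc_cnj_def)

lemma cocycle_edge:
  assumes "cocycle T z" "i < ntet T" "a \<le> 3" "a' \<le> 3" "a \<noteq> a'"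
  shows "z i a a' \<in> carrier PSL2C" "z i a' a = inv\<^bsub>PSL2C\<^esub> (z i a a')"
  using assms(1)[unfolded cocycle_def, THEN conjunct1, rule_format, OF assms(2-5)] by auto

lemma cocycle_mirror: "cocycle (mirror T) (cocyc_cnj z) \<longleftrightarrow> cocycle T z"
proof -
  have *: "cocycle (mirror T) (cocyc_cnj z)" if "cocycle T z" for T z
    unfolding cocycle_def cocyc_cnj_def mirror_simps
  proof (intro conjI)
    show "\<forall>i<ntet T. \<forall>a\<le>3. \<forall>a'\<le>3. a \<noteq> a' \<longrightarrow> psl_cnj (z i a a') \<in> carrier PSL2C \<and>
        psl_cnj (z i a' a) = inv\<^bsub>PSL2C\<^esub> psl_cnj (z i a a')"
    proof (intro allI impI conjI)
      fix i a a' :: nat assume "i < ntet T" "a \<le> 3" "a' \<le> 3" "a \<noteq> a'"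
      from cocycle_edge[OF that this]
      show "psl_cnj (z i a a') \<in> carrier PSL2C"
          "psl_cnj (z i a' a) = inv\<^bsub>PSL2C\<^esub> psl_cnj (z i a a')"
        by (simp_all add: psl_cnj_inv)
    qed
    show "\<forall>i<ntet T. \<forall>k\<le>3. \<forall>j \<sigma>. glue T i k = (j, \<sigma>) \<longrightarrow> (\<forall>a\<in>{..3}-{k}. \<forall>a'\<in>{..3}-{k}.
        a \<noteq> a' \<longrightarrow> psl_cnj (z i a a') = psl_cnj (z j (\<sigma> a) (\<sigma> a')))"
      using that unfolding cocycle_def by metis
    show "\<forall>i<ntet T. \<forall>a\<le>3. \<forall>a'\<le>3. \<forall>a''\<le>3. a \<noteq> a' \<and> a' \<noteq> a'' \<and> a \<noteq> a'' \<longrightarrow>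
        psl_cnj (z i a a') \<otimes>\<^bsub>PSL2C\<^esub> psl_cnj (z i a' a'') = psl_cnj (z i a a'')"
      using that unfolding cocycle_def psl_cnj_mult [symmetric] by metis
  qed
  from *[of T z] *[of "mirror T" "cocyc_cnj z"] show ?thesis by auto
qed

lemma branching_le_3: "branching T b \<Longrightarrow> i < ntet T \<Longrightarrow> m \<le> 3 \<Longrightarrow> b i m \<le> 3"
  by (auto simp: branching_def dest!: spec[of _ i] permutes_in_image[of _ _ m])

lemma branching_inj: "branching T b \<Longrightarrow> i < ntet T \<Longrightarrow> b i m = b i m' \<longleftrightarrow> m = m'"
  by (auto simp: branching_def dest!: spec[of _ i] permutes_inj injD)

text \<open>The Moebius action is given by rational functions with integer coefficients in the matrix entries and the
  point, and the base point 0 is real.\<close>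

lemma ideal_vertex_cnj:
  assumes "cocycle T z" "branching T b" "i < ntet T"
  shows "ideal_vertex b (cocyc_cnj z) i m = map_option cnj (ideal_vertex b z i m)"
proof -
  interpret group PSL2C by (rule group_PSL2C)
  have "z i (b i k) (b i l) \<in> carrier PSL2C" if "k \<le> 3" "l \<le> 3" "k \<noteq> l" for k l
  proof -
    have "b i k \<le> 3" "b i l \<le> 3" "b i k \<noteq> b i l"
      using that branching_le_3[OF assms(2,3)] branching_inj[OF assms(2,3)] by auto
    then show ?thesis using cocycle_edge(1)[OF assms(1,3)] by blast
  qed
  then have "z i (b i 0) (b i 1) \<in> carrier PSL2C" "z i (b i 1) (b i 2) \<in> carrier PSL2C"
      "z i (b i 2) (b i 3) \<in> carrier PSL2C" by auto
  note c = this m_closed[OF this(1,2)] m_closed[OF m_closed[OF this(1,2)] this(3)]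
  from c[THEN psl_act_cnj, of "Some 0"] show ?thesis
    by (simp add: ideal_vertex_def cocyc_cnj_def Let_def psl_cnj_mult)
qed

lemma idealizable_mirror:
  assumes "cocycle T z" "branching T b"
  shows "idealizable (mirror T) b (cocyc_cnj z) \<longleftrightarrow> idealizable T b z"
proof -
  have inj: "inj (map_option cnj)" by (rule option.inj_map) (auto simp: inj_def)
  have "inj_on (map_option cnj \<circ> f) A \<longleftrightarrow> inj_on f A" for f :: "nat \<Rightarrow> complex option" and A
    by (simp only: inj_on_def o_apply inj_eq[OF inj])
  moreover have "ideal_vertex b (cocyc_cnj z) i = map_option cnj \<circ> ideal_vertex b z i"
    if "i < ntet T" for i
    using ideal_vertex_cnj[OF assms that] by auto
  ultimately show ?thesis by (simp add: idealizable_def cong: conj_cong)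
qed

lemma pnum_cnj:
  assumes "cocycle T z" "branching T b" "idealizable T b z" "i < ntet T"
  shows "pnum b (cocyc_cnj z) i j = cnj (pnum b z i j)"
proof -
  have "the (ideal_vertex b (cocyc_cnj z) i m) = cnj (the (ideal_vertex b z i m))" if "m \<le> 3" for m
    using assms(3,4) that
    by (simp add: ideal_vertex_cnj[OF assms(1,2,4)] idealizable_def option.map_sel)
  then show ?thesis by (simp add: pnum_def Let_def)
qed

lemma D_triangulation_mirror:
  assumes "closed_oriented_3manifold W"
  shows "D_triangulation (opposite W) L (conj_bundle \<rho>) (mirror T) \<phi> H b (cocyc_cnj z) \<longleftrightarrow>
         D_triangulation W L \<rho> T \<phi> H b z"
proof -
  have "is_orientation (underlying W) (orientation W)"
    using assms by (simp add: closed_oriented_3manifold_def)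
  then show ?thesis
    unfolding D_triangulation_def distinguished_def cells_mirror
    using triangulates_mirror cocycle_mirror represents_mirror idealizable_mirror by blast
qed

lemma admissible_cuts_mirror:
  assumes "cocycle T z" "branching T b" "idealizable T b z" "N > 0" "admissible_cuts N T b z \<epsilon> \<theta>"
  shows "admissible_cuts N (mirror T) b (cocyc_cnj z) (- \<epsilon>) (\<lambda>i. - \<theta> i)"
proof -
  have "(\<forall>j<3. pnum b (cocyc_cnj z) i j * cis (- (- \<theta> i)) \<notin> \<real>\<^sub>\<le>\<^sub>0) \<and>
        - root_det N (- \<theta> i) (pnum b (cocyc_cnj z) i 2) / root_det N (- \<theta> i) (pnum b (cocyc_cnj z) i 1)
          \<in> cut_plane N (- \<epsilon>)" if i: "i < ntet T" for i
  proof -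
    let ?p = "pnum b z i"
    have nonpos: "?p j * cis (- \<theta> i) \<notin> \<real>\<^sub>\<le>\<^sub>0" if "j < 3" for j
      using assms(5) i that by (auto simp: admissible_cuts_def)
    have cut: "- root_det N (\<theta> i) (?p 2) / root_det N (\<theta> i) (?p 1) \<in> cut_plane N \<epsilon>"
      using assms(5) i by (auto simp: admissible_cuts_def)
    have "pnum b (cocyc_cnj z) i j * cis (- (- \<theta> i)) = cnj (?p j * cis (- \<theta> i))" for j
      by (simp add: pnum_cnj[OF assms(1-3) i] cis_cnj)
    moreover have "cnj (?p j * cis (- \<theta> i)) \<notin> \<real>\<^sub>\<le>\<^sub>0" if "j < 3" for j
      using nonpos[OF that] by (auto simp: complex_nonpos_Reals_iff)
    moreover have "root_det N (- \<theta> i) (pnum b (cocyc_cnj z) i j) = cnj (root_det N (\<theta> i) (?p j))"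
      if "j < 3" for j
      by (simp add: pnum_cnj[OF assms(1-3) i] cnj_root_det[OF nonpos[OF that]])
    ultimately show ?thesis
      using cnj_cut_plane[OF assms(4), THEN iffD2, OF cut] by simp
  qed
  then show ?thesis using assms(5) by (simp add: admissible_cuts_def)
qed

section \<open>Conjugation of state sums\<close>

text \<open>The Fermat relation between the \<open>N\<close>-th roots of the \<open>p\<^sub>j\<close> comes from here.\<close>

lemma sum_pnum: "pnum b z i 0 + pnum b z i 1 + pnum b z i 2 = 0"
  by (simp add: pnum_def Let_def algebra_simps)

lemma tet_index_mirror: "tet_index (mirror T) b i = - tet_index T b i"
  by (simp add: tet_index_def)

text \<open>The charges enter \<open>R_mat\<close> as \<open>\<beta> - c'\<^sub>0, \<gamma> - c'\<^sub>0\<close> and \<open>R_bar\<close> as \<open>\<beta> + c'\<^sub>0, \<gamma> + c'\<^sub>0\<close>; these opposite signs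
  are exactly what the negation of the indices in \<open>cnj_R_mat\<close> calls for. The same negation
  matches the conjugate of \<open>\<zeta> powi (c'\<^sub>1 (\<gamma> - \<alpha>))\<close>.\<close>

lemma cnj_tet_tensor_positive:
  assumes N: "odd N" and T: "cocycle T z" "branching T b" "idealizable T b z" and i: "i < ntet T"
    and a: "admissible_cuts N T b z \<epsilon> \<theta>" and pos: "tet_index T b i = 1"
    and s: "\<And>C. C \<in> cells T 2 \<Longrightarrow> [s' C = - s C] (mod int N)"
  shows "cnj (tet_tensor N T b z c \<epsilon> (\<theta> i) i s) =
         tet_tensor N (mirror T) b (cocyc_cnj z) c (- \<epsilon>) (- \<theta> i) i s'"
proof -
  have N0: "N > 0" using N by (rule odd_pos)
  define p where "p j = root_det N (\<theta> i) (pnum b z i j)" for j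
  have nonpos: "pnum b z i j * cis (- \<theta> i) \<notin> \<real>\<^sub>\<le>\<^sub>0" if "j < 3" for j
    using a i that by (auto simp: admissible_cuts_def)
  have cut: "- p 2 / p 1 \<in> cut_plane N \<epsilon>"
    using a i by (auto simp: admissible_cuts_def p_def)
  have p': "root_det N (- \<theta> i) (pnum b (cocyc_cnj z) i j) = cnj (p j)" if "j < 3" for j
    by (simp add: p_def pnum_cnj[OF T i] cnj_root_det[OF nonpos[OF that]])
  have p'_012: "root_det N (- \<theta> i) (pnum b (cocyc_cnj z) i 0) = cnj (p 0)"
      "root_det N (- \<theta> i) (pnum b (cocyc_cnj z) i 1) = cnj (p 1)"
      "root_det N (- \<theta> i) (pnum b (cocyc_cnj z) i 2) = cnj (p 2)" using p' by simp_all
  have pN: "p j ^ N = pnum b z i j" if "j < 3" for j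
    using nonpos[OF that] N0 unfolding p_def by (intro root_det_power) auto
  have Fermat: "p 1 ^ N + p 0 ^ N = (- p 2) ^ N"
  proof -
    have "p 1 ^ N + p 0 ^ N = pnum b z i 1 + pnum b z i 0" using pN[of 0] pN[of 1] by simp
    also have "\<dots> = - pnum b z i 2"
      using sum_pnum[of b z i] by (metis add.commute eq_neg_iff_add_eq_0)
    also have "\<dots> = (- p 2) ^ N" using pN[of 2] N by simp
    finally show ?thesis .
  qed
  define F where "F m = cell_of T i ({..3} - {b i m})" for m
  define c0 where "c0 = (half N * c i {b i 0, b i 1}) mod int N"
  define c1 where "c1 = (half N * c i {b i 1, b i 2}) mod int N"
  have "F m \<in> cells T 2" if "m \<le> 3" for m
  proof -
    have "card ({..3} - {b i m}) = 3" using branching_le_3[OF T(2) i that] by simp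
    then show ?thesis unfolding cells_def F_def using i by fastforce
  qed
  then have sF: "[s' (F m) = - s (F m)] (mod int N)" if "m \<le> 3" for m using s that by simp
  have R: "cnj (R_mat N \<epsilon> (p 1) (p 0) (- p 2) (s (F 3)) (s (F 1) - c0) (s (F 2) - c0) (s (F 0))) =
      R_bar N (- \<epsilon>) (cnj (p 1)) (cnj (p 0)) (cnj (- p 2)) (s' (F 3)) (s' (F 1) + c0) (s' (F 2) + c0) (s' (F 0))"
  proof (rule cnj_R_mat)
    have "[s' (F m) + c0 = - s (F m) + c0] (mod int N)" if "m \<le> 3" for m
      using sF[OF that] by (intro cong_add) auto
    then show "[s' (F 1) + c0 = - (s (F 1) - c0)] (mod int N)" "[s' (F 2) + c0 = - (s (F 2) - c0)] (mod int N)"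
      by (simp_all add: algebra_simps)
    show "\<bar>\<epsilon>\<bar> < pi / 2" using a by (simp add: admissible_cuts_def)
  qed (use N cut sF Fermat in \<open>auto simp: p_def\<close>)
  have "[c1 * (s' (F 2) - s' (F 3)) = c1 * (- s (F 2) - - s (F 3))] (mod int N)"
    using sF by (intro cong_mult cong_diff) auto
  from zeta_powi_cong[OF N0 this]
  have Z: "cnj (zeta N powi (c1 * (s (F 2) - s (F 3)))) = zeta N powi (c1 * (s' (F 2) - s' (F 3)))"
    unfolding cnj_zeta_powi by (simp add: algebra_simps)
  show ?thesis
    unfolding tet_tensor_def Let_def tet_index_mirror pos cells_mirror p'_012
      p_def [symmetric] F_def [symmetric] c0_def [symmetric] c1_def [symmetric]
    using R Z by simp
qed

text \<open>A tetrahedron of index \<open>-1\<close> is the mirror image of one of index 1, so this case is the conjugate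
  of the previous one.\<close>

lemma cnj_tet_tensor:
  assumes N: "odd N" and g: "gluing_ok T" and T: "cocycle T z" "branching T b" "idealizable T b z"
    and i: "i < ntet T" and a: "admissible_cuts N T b z \<epsilon> \<theta>"
    and s: "\<And>C. C \<in> cells T 2 \<Longrightarrow> [s' C = - s C] (mod int N)"
  shows "cnj (tet_tensor N T b z c \<epsilon> (\<theta> i) i s) =
         tet_tensor N (mirror T) b (cocyc_cnj z) c (- \<epsilon>) (- \<theta> i) i s'"
proof (cases "tet_index T b i = 1")
  case True
  then show ?thesis using cnj_tet_tensor_positive[where s = s and s' = s'] assms by blast
next
  case False
  have "ori T i \<in> {1, -1}" using g i by (auto simp: gluing_ok_def)
  then have "tet_index (mirror T) b i = 1"
    using False by (auto simp: tet_index_def sign_def)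
  moreover have "[s C = - s' C] (mod int N)" if "C \<in> cells T 2" for C
    using cong_minus_minus_iff[of "s' C" "- s C"] s[OF that] by (simp add: cong_sym_eq)
  moreover have "admissible_cuts N (mirror T) b (cocyc_cnj z) (- \<epsilon>) (\<lambda>i. - \<theta> i)"
    using admissible_cuts_mirror T a N odd_pos by blast
  ultimately have "cnj (tet_tensor N (mirror T) b (cocyc_cnj z) c (- \<epsilon>) (- \<theta> i) i s') =
      tet_tensor N (mirror (mirror T)) b (cocyc_cnj (cocyc_cnj z)) c (- (- \<epsilon>)) (- (- \<theta> i)) i s"
    using T i N
    by (intro cnj_tet_tensor_positive[where \<theta> = "\<lambda>i. - \<theta> i"])
       (simp_all add: cocycle_mirror idealizable_mirror)
  then show ?thesis by (metis cocyc_cnj_cocyc_cnj complex_cnj_cnj minus_minus mirror_simps(4))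
qed

text \<open>Negation modulo \<open>N\<close> permutes the states, so the tensorwise identity survives summation.\<close>

lemma cnj_H_value:
  assumes "odd N" "gluing_ok T" "cocycle T z" "branching T b" "idealizable T b z"
    and "admissible_cuts N T b z \<epsilon> \<theta>"
  shows "cnj (H_value N T b z c \<epsilon> \<theta>) =
         H_value N (mirror T) b (cocyc_cnj z) c (- \<epsilon>) (\<lambda>i. - \<theta> i)"
proof -
  have N0: "N > 0" using assms(1) by (rule odd_pos)
  define S where "S = cells T 2 \<rightarrow>\<^sub>E {0..<int N}"
  define neg where "neg s = (\<lambda>C\<in>cells T 2. (- s C) mod int N)" for s :: "(nat \<times> nat set) set \<Rightarrow> int"
  have neg_S: "neg s \<in> S" for s using N0 by (auto simp: neg_def S_def)
  have neg_neg: "neg (neg s) = s" if "s \<in> S" for s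
  proof
    fix C
    show "neg (neg s) C = s C"
    proof (cases "C \<in> cells T 2")
      case True
      then have "s C \<in> {0..<int N}" using that by (auto simp: S_def)
      then show ?thesis using True by (simp add: neg_def mod_minus_eq)
    qed (use that in \<open>auto simp: neg_def S_def PiE_def extensional_def\<close>)
  qed
  have "cnj (state_sum N T b z c \<epsilon> \<theta>) =
      (\<Sum>s\<in>S. \<Prod>i<ntet T. tet_tensor N (mirror T) b (cocyc_cnj z) c (- \<epsilon>) (- \<theta> i) i (neg s))"
    unfolding state_sum_def S_def cnj_sum cnj_prod
    by (intro sum.cong prod.cong refl cnj_tet_tensor) (use assms in \<open>auto simp: neg_def cong_def\<close>)
  also have "\<dots> = (\<Sum>s\<in>S. \<Prod>i<ntet T. tet_tensor N (mirror T) b (cocyc_cnj z) c (- \<epsilon>) (- \<theta> i) i s)"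
    by (rule sum.reindex_bij_witness[of _ neg neg]) (auto simp: neg_S neg_neg)
  also have "\<dots> = state_sum N (mirror T) b (cocyc_cnj z) c (- \<epsilon>) (\<lambda>i. - \<theta> i)"
    by (simp add: state_sum_def S_def)
  finally show ?thesis by (simp add: H_value_def)
qed

text \<open>Every charged triangulation of the mirror image is itself a mirror image, as mirroring is an
  involution on triangulations and cocycles.\<close>

lemma cnj_H_values:
  assumes W: "closed_oriented_3manifold W" and N: "odd N"
  shows "cnj ` H_values N W L \<rho> = H_values N (opposite W) L (conj_bundle \<rho>)"
proof (intro equalityI subsetI)
  have D: "gluing_ok T" "cocycle T z" "branching T b" "idealizable T b z"
    if "D_triangulation W L \<rho> T \<phi> H b z" for T \<phi> H b z
    using that by (auto simp: D_triangulation_def distinguished_def triangulates_def)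
  {
    fix v assume "v \<in> cnj ` H_values N W L \<rho>"
    then obtain T \<phi> H b z c \<epsilon> \<theta> where v: "v = cnj (H_value N T b z c \<epsilon> \<theta>)"
      and T: "D_triangulation W L \<rho> T \<phi> H b z" and c: "integral_charge W T \<phi> H c"
      and a: "admissible_cuts N T b z \<epsilon> \<theta>" by (auto simp: H_values_def)
    have "v = H_value N (mirror T) b (cocyc_cnj z) c (- \<epsilon>) (\<lambda>i. - \<theta> i)"
      using v cnj_H_value[OF N D[OF T] a] by simp
    moreover have "admissible_cuts N (mirror T) b (cocyc_cnj z) (- \<epsilon>) (\<lambda>i. - \<theta> i)"
      using admissible_cuts_mirror D[OF T] a N odd_pos by blast
    ultimately show "v \<in> H_values N (opposite W) L (conj_bundle \<rho>)"
      using T c D_triangulation_mirror[OF W] integral_charge_mirror unfolding H_values_def by blast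
  next
    fix v assume "v \<in> H_values N (opposite W) L (conj_bundle \<rho>)"
    then obtain T' \<phi> H b z' c \<epsilon> \<theta> where v: "v = H_value N T' b z' c \<epsilon> \<theta>"
      and T': "D_triangulation (opposite W) L (conj_bundle \<rho>) T' \<phi> H b z'"
      and c: "integral_charge (opposite W) T' \<phi> H c"
      and a': "admissible_cuts N T' b z' \<epsilon> \<theta>" by (auto simp: H_values_def)
    define T z where "T = mirror T'" and "z = cocyc_cnj z'"
    then have T'z': "T' = mirror T" "z' = cocyc_cnj z" by simp_all
    have T: "D_triangulation W L \<rho> T \<phi> H b z"
      by (rule D_triangulation_mirror[OF W, THEN iffD1, OF T'[unfolded T'z']])
    have "admissible_cuts N (mirror T') b (cocyc_cnj z') (- \<epsilon>) (\<lambda>i. - \<theta> i)"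
      using D[OF T] a' N odd_pos cocycle_mirror idealizable_mirror unfolding T'z'
      by (intro admissible_cuts_mirror) (auto simp: cocycle_mirror idealizable_mirror)
    then have a: "admissible_cuts N T b z (- \<epsilon>) (\<lambda>i. - \<theta> i)" by (simp add: T_def z_def)
    have "v = cnj (H_value N T b z c (- \<epsilon>) (\<lambda>i. - \<theta> i))"
      using cnj_H_value[OF N D[OF T] a] v T'z' by simp
    moreover have "integral_charge W T \<phi> H c" using c T'z' by (simp add: integral_charge_mirror)
    ultimately show "v \<in> cnj ` H_values N W L \<rho>"
      using T a unfolding H_values_def by blast
  }
qed

section \<open>The invariant\<close>

lemma eq_pm_root_sym:
  assumes "N > 0" "eq_pm_root N x y"
  shows "eq_pm_root N y x"
proof -
  obtain u where u: "u ^ N = 1" "x = u * y \<or> x = - (u * y)"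
    using assms(2) by (auto simp: eq_pm_root_def)
  then have "u \<noteq> 0" using assms(1) by (auto simp: zero_power)
  then show ?thesis using u unfolding eq_pm_root_def
    by (intro exI[of _ "inverse u"]) (auto simp: power_inverse)
qed

lemma eq_pm_root_trans:
  assumes "eq_pm_root N x y" "eq_pm_root N y w"
  shows "eq_pm_root N x w"
proof -
  obtain u v where "u ^ N = 1" "x = u * y \<or> x = - (u * y)" "v ^ N = 1" "y = v * w \<or> y = - (v * w)"
    using assms by (auto simp: eq_pm_root_def)
  then show ?thesis unfolding eq_pm_root_def
    by (intro exI[of _ "u * v"]) (auto simp: power_mult_distrib)
qed

lemma eq_pm_root_cnj: "eq_pm_root N (cnj x) (cnj y) \<longleftrightarrow> eq_pm_root N x y"
proof -
  have "eq_pm_root N (cnj x) (cnj y)" if xy: "eq_pm_root N x y" for x y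
  proof -
    obtain u where "u ^ N = 1" "x = u * y \<or> x = - (u * y)" using xy by (auto simp: eq_pm_root_def)
    then show ?thesis unfolding eq_pm_root_def
      by (intro exI[of _ "cnj u"]) (auto simp flip: complex_cnj_power)
  qed
  from this[of x y] this[of "cnj x" "cnj y"] show ?thesis by auto
qed

theorem proposition4p29:
  fixes W :: "'a oriented_space" and L :: "'a set" and \<rho> :: "('a, 'e) psl_bundle" and N :: nat
  assumes "closed_oriented_3manifold W"
    and "is_link W L" and "L \<noteq> {}"
    and "flat_psl_bundle W \<rho>"
    and "odd N" and "N > 1"
  shows "cnj ` H_class N W L \<rho> = H_class N (opposite W) L (conj_bundle \<rho>) \<and>
    (\<forall>x y. is_H N W L \<rho> x \<longrightarrow> is_H N (opposite W) L (conj_bundle \<rho>) y \<longrightarrow>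
       eq_pm_root N (cnj x) y)"
proof (intro conjI allI impI)
  let ?V = "H_values N W L \<rho>" and ?V' = "H_values N (opposite W) L (conj_bundle \<rho>)"
  have V': "?V' = cnj ` ?V" by (rule cnj_H_values[OF assms(1,5), symmetric])
  have "x \<in> cnj ` H_class N W L \<rho> \<longleftrightarrow> cnj x \<in> H_class N W L \<rho>" for x
    by (metis complex_cnj_cnj image_iff)
  then show "cnj ` H_class N W L \<rho> = H_class N (opposite W) L (conj_bundle \<rho>)"
    using eq_pm_root_cnj by (auto simp: H_class_def V') (metis complex_cnj_cnj eq_pm_root_cnj)+
  fix x y assume x: "is_H N W L \<rho> x" and y: "is_H N (opposite W) L (conj_bundle \<rho>) y"
  then obtain v where v: "v \<in> ?V" by (auto simp: is_H_def)
  then have "eq_pm_root N (cnj x) (cnj v)" using x by (simp add: is_H_def eq_pm_root_cnj)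
  moreover have "eq_pm_root N (cnj v) y"
    using y v V' assms(6) by (auto simp: is_H_def intro: eq_pm_root_sym)
  ultimately show "eq_pm_root N (cnj x) y" by (rule eq_pm_root_trans)
qed

end
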